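(* Let $E$ be a Hermite–Biehler entire function with no real zeros whose phase function satisfies $\varphi'\in L^\infty(\mathbb{R})$, let $p\geq 1$ and $\xi\in\mathbb{R}$, and let $f\in\mathcal{H}^p(E)$ be a nonzero function satisfying $$\lvert f(\xi)/E(\xi)\rvert = C(p,E,\xi)\,\lVert f/E\rVert_p.$$ Then the zeros of $f$ are uniformly separated, i.e. there exists $\delta>0$ such that $\lvert\lambda_1-\lambda_2\rvert>\delta$ for all distinct zeros $\lambda_1,\lambda_2$ of $f$.
   Context: An entire function $E$ is Hermite–Biehler if $\lvert E(\overline{z})\rvert < \lvert E(z)\rvert$ for $z$ in the upper half-plane $\mathbb{C}_+$. Let $E^{\#}(z)=\overline{E(\overline z)}$; the phase function $\varphi$ is a smooth real function on $\mathbb{R}$ with $E^{\#}(x)/E(x) = e^{i\varphi(x)}$ (equivalently $\varphi=-2\arg E$ on $\mathbb{R}$). For $0<p<\infty$, $\mathcal{H}^p(E)$ is the space of entire $f$ such that $f/E$ and $f^{\#}/E$ belong to the Hardy space $H^p(\mathbb{C}_+)$, with $\lVert f/E\rVert_p = (\int_{\mathbb{R}}\lvert f(x)/E(x)\rvert^p dx)^{1/p}$. For $\xi\in\mathbb{R}$, $C(p,E,\xi)$ is the smallest constant such that $\lvert f(\xi)/E(\xi)\rvert\le C(p,E,\xi)\lVert f/E\rVert_p$ for all $f\in\mathcal{H}^p(E)$. *)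

theory Defs
  imports "HOL-Analysis.Analysis"
begin

definition hermite_biehler :: "(complex \<Rightarrow> complex) \<Rightarrow> bool" where
  "hermite_biehler E \<longleftrightarrow> E holomorphic_on UNIV \<and>
     (\<forall>z. Im z > 0 \<longrightarrow> cmod (E (cnj z)) < cmod (E z))"

definition sharp :: "(complex \<Rightarrow> complex) \<Rightarrow> complex \<Rightarrow> complex" where
  "sharp E = (\<lambda>z. cnj (E (cnj z)))"

definition hardy_upper :: "real \<Rightarrow> (complex \<Rightarrow> complex) set" where
  "hardy_upper p = {g. g holomorphic_on {z. Im z > 0} \<and>
     (SUP y\<in>{0<..}. \<integral>\<^sup>+ x. ennreal (cmod (g (Complex x y)) powr p) \<partial>lborel) < \<infinity>}"

definition HpE :: "real \<Rightarrow> (complex \<Rightarrow> complex) \<Rightarrow> (complex \<Rightarrow> complex) set" where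
  "HpE p E = {f. f holomorphic_on UNIV \<and>
     (\<lambda>z. f z / E z) \<in> hardy_upper p \<and> (\<lambda>z. sharp f z / E z) \<in> hardy_upper p}"

definition normE :: "real \<Rightarrow> (complex \<Rightarrow> complex) \<Rightarrow> (complex \<Rightarrow> complex) \<Rightarrow> real" where
  "normE p E f = (\<integral>x. cmod (f (of_real x) / E (of_real x)) powr p \<partial>lborel) powr (1 / p)"

definition point_const :: "real \<Rightarrow> (complex \<Rightarrow> complex) \<Rightarrow> real \<Rightarrow> real" where
  "point_const p E \<xi> = Inf {C. \<forall>f\<in>HpE p E.
      cmod (f (of_real \<xi>) / E (of_real \<xi>)) \<le> C * normE p E f}"

definition phase_function :: "(complex \<Rightarrow> complex) \<Rightarrow> (real \<Rightarrow> real) \<Rightarrow> bool" where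
  "phase_function E \<phi> \<longleftrightarrow> (\<forall>x. \<phi> differentiable at x) \<and>
     (\<forall>x. sharp E (of_real x) / E (of_real x) = exp (\<i> * of_real (\<phi> x)))"

end

theory Submission
  imports Defs "HOL-Complex_Analysis.Complex_Analysis" "HOL-Probability.Sinc_Integral" "HOL-Real_Asymp.Real_Asymp"
begin

text \<open>
  Let \<open>\<Theta> = E\<^sup>#/E\<close>. Since \<open>\<bar>\<Theta>'\<bar> = \<bar>\<phi>'\<bar>\<close> is bounded by \<open>M\<close> on the real line, a maximum principle gives
  \<open>\<bar>\<Theta>\<bar> \<ge> 1/2\<close> in the strip \<open>0 \<le> Im z \<le> 1/(2M)\<close>; hence quotients \<open>f/E\<close> continue into the lower half-plane with
  control by \<open>f\<^sup>#/E\<close>, and point evaluation on \<open>HpE p E\<close> is bounded uniformly over the real line.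

  If \<open>f\<close> is extremal and \<open>g\<close> vanishes at \<open>\<xi>\<close>, perturbing \<open>f\<close> to \<open>f + t g\<close> yields
  \<open>\<integral> \<bar>f/E\<bar>\<^sup>p Re (g/f) = 0\<close>. Dividing out one nonreal zero contradicts this, so all zeros are real. For two real zeros
  \<open>a < b\<close> take \<open>g = f r\<close> with \<open>r(x) = (x - \<xi>)\<^sup>2 / ((x - a) (x - b))\<close>, which is negative only on \<open>(a, b)\<close>: the integral over
  \<open>(a, b)\<close> balances the one outside. If \<open>b - a\<close> is small and \<open>a\<close> is far from \<open>\<xi>\<close>, the former is at most a multiple of
  \<open>(b - a) S\<close> with \<open>S\<close> the maximum of \<open>\<bar>g/E\<bar>\<^sup>p\<close> near \<open>[a, b]\<close>, while uniform point evaluation bounds the latter from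
  below by a multiple of \<open>S\<close>. Near \<open>\<xi>\<close> there are only finitely many zeros.
\<close>

section \<open>A pointwise bound in the upper half-plane\<close>

text \<open>Rotation by \<open>\<i>\<close> turns the horizontal segment into a vertical one, to
  which \<open>contour_integral_linepath_same_Re\<close> applies.\<close>

lemma contour_integral_linepath_same_Im:
  assumes "a < b"
  shows "contour_integral (linepath (Complex a v) (Complex b v)) Q = integral {a..b} (\<lambda>u. Q (Complex u v))"
proof -
  have "\<i> * contour_integral (linepath (Complex a v) (Complex b v)) Q =
      contour_integral (linepath (\<i> * Complex a v) (\<i> * Complex b v)) (\<lambda>w. Q (- \<i> * w))"
    by (simp add: contour_integral_integral linepath_def scaleR_conv_of_real algebra_simps
          flip: integral_mult_right)
  also have "\<dots> = \<i> * integral {a..b} (\<lambda>u. Q (- \<i> * Complex (- v) u))"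
    using assms by (intro contour_integral_linepath_same_Re) auto
  also have "(\<lambda>u. Q (- \<i> * Complex (- v) u)) = (\<lambda>u. Q (Complex u v))"
    by (intro ext arg_cong[of _ _ Q]) (simp add: complex_eq_iff)
  finally show ?thesis by simp
qed

lemma norm_integral_le_nn_integral:
  fixes g :: "real \<Rightarrow> complex" and q :: "real \<Rightarrow> real"
  assumes "continuous_on {a..b} g" "continuous_on UNIV q" "\<And>u. u \<in> {a..b} \<Longrightarrow> cmod (g u) \<le> q u" "\<And>u. 0 \<le> q u"
  shows "ennreal (cmod (integral {a..b} g)) \<le> (\<integral>\<^sup>+u. ennreal (q u) * indicator {a..b} u \<partial>lborel)"
proof -
  have q: "q integrable_on {a..b}" "q \<in> borel_measurable borel"
    using assms(2) by (auto intro!: integrable_continuous_real borel_measurable_continuous_onI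
        intro: continuous_on_subset)
  have "cmod (integral {a..b} g) \<le> integral {a..b} q"
    using assms q by (intro integral_norm_bound_integral) (auto intro: integrable_continuous_real)
  also have "ennreal (integral {a..b} q) = (\<integral>\<^sup>+u. ennreal (q u * indicator {a..b} u) \<partial>lborel)"
  proof (rule nn_integral_has_integral_lborel[symmetric])
    have "((\<lambda>u. if u \<in> {a..b} then q u else 0) has_integral integral {a..b} q) UNIV"
      by (subst has_integral_restrict_UNIV) (rule integrable_integral[OF q(1)])
    thus "((\<lambda>u. q u * indicator {a..b} u) has_integral integral {a..b} q) UNIV"
      by (rule has_integral_eq_rhs[OF has_integral_cong[THEN iffD1, rotated]]) (auto simp: indicator_def)
  qed (use assms q in auto)
  finally show ?thesis
    using assms(4) by (simp add: ennreal_mult' ennreal_leI flip: ennreal_indicator)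
qed

lemma nn_integral_inverse_1_plus_square:
  "(\<integral>\<^sup>+u. ennreal (inverse (1 + (u - c)\<^sup>2)) \<partial>lborel) = ennreal pi"
proof -
  have int: "integrable lborel (\<lambda>x::real. inverse (1 + x^2))"
    using integrable_inverse_1_plus_square by (simp add: set_integrable_def)
  have "(\<integral>\<^sup>+u. ennreal (inverse (1 + (u - c)\<^sup>2)) \<partial>lborel) = (\<integral>\<^sup>+u. ennreal (inverse (1 + u\<^sup>2)) \<partial>lborel)"
    by (subst nn_integral_real_affine[where t = c and c = 1]) auto
  also have "\<dots> = ennreal pi"
    using LBINT_inverse_1_plus_square
    by (subst nn_integral_eq_integral[OF int]) (auto simp: interval_lebesgue_integral_def set_lebesgue_integral_def)
  finally show ?thesis .
qed

text \<open>A substitute for Hoelder's inequality: against a bounded weight of finite mass, a bound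
  on the integral of the \<open>p\<close>-th power gives one on that of the first power. The
  homogeneity lost here is restored by normalising in \<open>half_plane_bound\<close>.\<close>

lemma one_plus_powr_ge:
  fixes x p :: real
  assumes "p \<ge> 1" "x \<ge> 0"
  shows "x \<le> 1 + x powr p"
proof (cases "x \<le> 1")
  case True
  then show ?thesis using powr_ge_zero[of x p] by linarith
next
  case False
  then have "x powr 1 \<le> x powr p" using assms by (intro powr_mono) auto
  then show ?thesis using False by simp
qed

text \<open>The kernel is \<open>1 / (w - z) - 1 / (w - cnj z)\<close>, on the real line a multiple
  of the Poisson kernel; the second term buys quadratic decay. The three bounds serve the bottom,
  the vertical sides and the top of a large rectangle.\<close>

lemma half_plane_kernel_bounds:
  assumes z: "0 < Im z" "Im z \<le> 1"
  shows "cmod (2 * \<i> * Im z / ((of_real u - cnj z) * (of_real u - z))) \<le> 2 / Im z * inverse (1 + (u - Re z)\<^sup>2)"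
    and "T > 0 \<Longrightarrow> \<bar>Re w - Re z\<bar> \<ge> T \<Longrightarrow> cmod (2 * \<i> * Im z / ((w - cnj z) * (w - z))) \<le> 2 * Im z / T\<^sup>2"
    and "T \<ge> 2 \<Longrightarrow> Im w = T \<Longrightarrow> cmod (2 * \<i> * Im z / ((w - cnj z) * (w - z))) \<le> 4 * Im z / T\<^sup>2"
proof -
  have eq: "cmod (of_real u - z) = sqrt ((u - Re z)\<^sup>2 + (Im z)\<^sup>2)"
    "cmod (of_real u - cnj z) = sqrt ((u - Re z)\<^sup>2 + (Im z)\<^sup>2)"
    by (auto simp: cmod_def)
  have le: "(u - Re z)\<^sup>2 + (Im z)\<^sup>2 \<ge> (Im z)\<^sup>2 * (1 + (u - Re z)\<^sup>2)"
    using z by (simp add: algebra_simps mult_left_le_one_le power_le_one)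
  have p: "0 < 1 + (u - Re z)\<^sup>2"
    by (rule add_pos_nonneg) auto
  have q1: "0 < (Im z)\<^sup>2 * (1 + (u - Re z)\<^sup>2)"
    using p z by simp
  with le have q2: "0 < (u - Re z)\<^sup>2 + (Im z)\<^sup>2" by linarith
  have "cmod (2 * \<i> * Im z / ((of_real u - cnj z) * (of_real u - z))) = 2 * Im z / ((u - Re z)\<^sup>2 + (Im z)\<^sup>2)"
    using z by (simp add: norm_mult norm_divide eq)
  also have "\<dots> \<le> 2 * Im z / ((Im z)\<^sup>2 * (1 + (u - Re z)\<^sup>2))"
    by (rule divide_left_mono[OF le]) (use z mult_pos_pos[OF q2 q1] in simp_all)
  also have "\<dots> = 2 / Im z * inverse (1 + (u - Re z)\<^sup>2)"
    using z by (simp add: divide_inverse power2_eq_square)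
  finally show "cmod (2 * \<i> * Im z / ((of_real u - cnj z) * (of_real u - z))) \<le> 2 / Im z * inverse (1 + (u - Re z)\<^sup>2)" .
next
  assume T: "T > 0" "\<bar>Re w - Re z\<bar> \<ge> T"
  have "T \<le> cmod (w - z)" "T \<le> cmod (w - cnj z)"
    using T abs_Re_le_cmod[of "w - z"] abs_Re_le_cmod[of "w - cnj z"] by auto
  then have "T\<^sup>2 \<le> cmod (w - cnj z) * cmod (w - z)"
    unfolding power2_eq_square using T by (intro mult_mono) auto
  then show "cmod (2 * \<i> * Im z / ((w - cnj z) * (w - z))) \<le> 2 * Im z / T\<^sup>2"
    using z T by (auto simp: norm_mult norm_divide intro!: divide_left_mono mult_pos_pos)
next
  assume T: "T \<ge> 2" "Im w = T"
  have "T / 2 \<le> cmod (w - z)" "T \<le> cmod (w - cnj z)"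
    using T z abs_Im_le_cmod[of "w - z"] abs_Im_le_cmod[of "w - cnj z"] by auto
  then have "T * (T / 2) \<le> cmod (w - cnj z) * cmod (w - z)"
    using T by (intro mult_mono) auto
  then have "2 * Im z / (cmod (w - cnj z) * cmod (w - z)) \<le> 2 * Im z / (T * (T / 2))"
    using z T by (intro divide_left_mono mult_pos_pos) (auto intro: order_less_le_trans)
  then show "cmod (2 * \<i> * Im z / ((w - cnj z) * (w - z))) \<le> 4 * Im z / T\<^sup>2"
    using z T by (simp add: norm_mult norm_divide power2_eq_square)
qed

text \<open>Cauchy's formula for \<open>G\<close>: the reflected point \<open>cnj z\<close> lies
  below the rectangle, so \<open>G\<close> is holomorphic there, and the factor multiplying
  \<open>F\<close> equals 1 at \<open>z\<close>.\<close>

lemma half_plane_rectangle_formula: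
  fixes F :: "complex \<Rightarrow> complex"
  assumes F: "F holomorphic_on {w. Im w \<ge> 0}"
    and z: "0 < Im z" "Im z < T" and R: "R > 0"
  defines "Q \<equiv> \<lambda>w. F w * (2 * \<i> * Im z / ((w - cnj z) * (w - z)))"
  shows "2 * pi * cmod (F z) \<le> cmod (integral {Re z - R..Re z + R} (\<lambda>u. Q (Complex u 0)))
     + cmod (integral {Re z - R..Re z + R} (\<lambda>u. Q (Complex u T)))
     + cmod (integral {0..T} (\<lambda>v. Q (Complex (Re z + R) v)))
     + cmod (integral {0..T} (\<lambda>v. Q (Complex (Re z - R) v)))"
proof -
  define a b where "a = Complex (Re z - R) 0" and "b = Complex (Re z + R) T"
  define a2 b2 where "a2 = Complex (Re z + R) 0" and "b2 = Complex (Re z - R) T"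
  define S where "S = {w. Im w \<ge> 0}"
  define G where "G = (\<lambda>w. F w * (2 * \<i> * Im z / (w - cnj z)))"
  have nz: "w - cnj z \<noteq> 0" if "w \<in> S" for w
    using that z by (auto simp: S_def complex_eq_iff)
  have G: "G holomorphic_on S"
    unfolding G_def using F nz by (auto simp: S_def intro!: holomorphic_intros)
  have Q: "Q = (\<lambda>w. G w / (w - z))"
    by (auto simp: G_def Q_def)
  have Gz: "G z = F z"
  proof -
    have "z - cnj z = 2 * \<i> * Im z" by (simp add: complex_eq_iff)
    with z show ?thesis by (simp add: G_def)
  qed
  have S: "convex S" "z \<in> interior S"
  proof -
    show "convex S" unfolding S_def by (rule convex_halfspace_Im_ge)
    have "{w. Im w > 0} \<subseteq> S" "open {w. Im w > 0}" by (auto simp: S_def open_halfspace_Im_gt)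
    then show "z \<in> interior S" using z by (meson interior_maximal mem_Collect_eq subsetD)
  qed
  have img: "path_image (rectpath a b) \<subseteq> S - {z}"
    using z R by (subst path_image_rectpath) (auto simp: a_def b_def S_def)
  have wn: "winding_number (rectpath a b) z = 1"
    using z R by (intro winding_number_rectpath) (auto simp: a_def b_def in_box_complex_iff)
  have "(Q has_contour_integral (2 * pi * \<i> * F z)) (rectpath a b)"
    using Cauchy_integral_formula_convex_simple[OF S(1) G S(2) _ img] wn Gz by (simp add: Q)
  moreover have contQ: "continuous_on (S - {z}) Q"
    unfolding Q by (rule continuous_on_divide[OF continuous_on_subset[OF holomorphic_on_imp_continuous_on[OF G]]])
       (auto intro!: continuous_intros)
  have sub: "closed_segment a a2 \<subseteq> S - {z}" "closed_segment a2 b \<subseteq> S - {z}"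
     "closed_segment b b2 \<subseteq> S - {z}" "closed_segment b2 a \<subseteq> S - {z}"
    using img by (auto simp: rectpath_def Let_def path_image_join a_def b_def a2_def b2_def)
  have cint: "Q contour_integrable_on linepath a a2" "Q contour_integrable_on linepath a2 b" 
     "Q contour_integrable_on linepath b b2"  "Q contour_integrable_on linepath b2 a"
    using sub contQ by (auto intro!: contour_integrable_continuous_linepath intro: continuous_on_subset)
  have "contour_integral (rectpath a b) Q = contour_integral (linepath a a2) Q + (contour_integral (linepath a2 b) Q
      + (contour_integral (linepath b b2) Q + contour_integral (linepath b2 a) Q))"
    using cint by (simp add: rectpath_def Let_def a_def b_def a2_def b2_def)
  ultimately have "2 * pi * \<i> * F z = contour_integral (linepath a a2) Q + (contour_integral (linepath a2 b) Q
      + (contour_integral (linepath b b2) Q + contour_integral (linepath b2 a) Q))"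
    using contour_integral_unique by metis
  then have "cmod (2 * pi * \<i> * F z) \<le> cmod (contour_integral (linepath a a2) Q) + (cmod (contour_integral (linepath a2 b) Q)
      + (cmod (contour_integral (linepath b b2) Q) + cmod (contour_integral (linepath b2 a) Q)))"
    by (simp only:) (intro norm_triangle_le add_left_mono order_refl)
  moreover have "contour_integral (linepath a a2) Q = integral {Re z - R..Re z + R} (\<lambda>u. Q (Complex u 0))"
    unfolding a_def a2_def using R by (intro contour_integral_linepath_same_Im) auto
  moreover have "contour_integral (linepath a2 b) Q = \<i> * integral {0..T} (\<lambda>v. Q (Complex (Re z + R) v))"
    unfolding b_def a2_def using z by (intro contour_integral_linepath_same_Re) auto
  moreover have "contour_integral (linepath b b2) Q = - integral {Re z - R..Re z + R} (\<lambda>u. Q (Complex u T))"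
    unfolding b_def b2_def using R
    by (subst contour_integral_linepath_same_Im[symmetric])
       (auto intro!: contour_integral_reverse_linepath continuous_on_subset[OF contQ] sub(3)[unfolded b_def b2_def])
  moreover have "contour_integral (linepath b2 a) Q = - (\<i> * integral {0..T} (\<lambda>v. Q (Complex (Re z - R) v)))"
  proof -
    have "contour_integral (linepath b2 a) Q = - contour_integral (linepath a b2) Q"
      by (intro contour_integral_reverse_linepath continuous_on_subset[OF contQ] sub(4))
    also have "contour_integral (linepath a b2) Q = \<i> * integral {0..T} (\<lambda>v. Q (Complex (Re z - R) v))"
      unfolding a_def b2_def using z by (intro contour_integral_linepath_same_Re) auto
    finally show ?thesis .
  qed
  ultimately show ?thesis
    by (simp add: norm_mult algebra_simps)
qed

text \<open>No pointwise bound controls \<open>\<phi>\<close> on vertical lines, so the half-width \<open>R\<close> of the rectangle is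
  found by averaging over \<open>{T..2 * T}\<close>.\<close>
lemma half_plane_good_width:
  fixes \<phi> :: "real \<Rightarrow> real \<Rightarrow> real"
  assumes cont: "continuous_on UNIV (\<lambda>(u, v). \<phi> u v)" and nonneg: "\<And>u v. \<phi> u v \<ge> 0"
    and p: "p \<ge> 1" and T: "T > 0" and M: "M \<ge> 0"
    and int: "\<And>v. v \<ge> 0 \<Longrightarrow> (\<integral>\<^sup>+u. ennreal (\<phi> u v powr p) \<partial>lborel) \<le> ennreal M"
  obtains R where "T \<le> R" "R \<le> 2 * T"
    "(\<integral>\<^sup>+v. ennreal (\<phi> (c + R) v + \<phi> (c - R) v) * indicator {0..T} v \<partial>lborel) \<le> ennreal (2 * (T + M) + 1)"
proof (rule ccontr)
  assume neg: "\<not> thesis"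
  have [measurable]: "(\<lambda>(u, v). \<phi> u v) \<in> borel_measurable (borel \<Otimes>\<^sub>M borel)"
    using borel_measurable_continuous_onI[OF cont] by (simp add: borel_prod)
  have [measurable]: "(\<lambda>u. \<phi> u v) \<in> borel_measurable borel" for v
    using measurable_compose[OF measurable_Pair2'[of v borel borel] \<open>(\<lambda>(u, v). \<phi> u v) \<in> _\<close>] by auto
  define h where "h = (\<lambda>R. \<integral>\<^sup>+v. ennreal (\<phi> (c + R) v + \<phi> (c - R) v) * indicator {0..T} v \<partial>lborel)"
  have big: "h R \<ge> ennreal (2 * (T + M) + 1)" if "T \<le> R" "R \<le> 2 * T" for R
    using neg that(1,2) \<open>\<And>R. T \<le> R \<Longrightarrow> _ \<Longrightarrow> _ \<Longrightarrow> thesis\<close> unfolding h_def by (meson linear)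
  \<comment> \<open>The sign \<open>s\<close> covers both vertical sides; translation and reflection
    turn the integral over \<open>R\<close> into one along the horizontal line at height
    \<open>v\<close>.\<close>
  have one: "(\<integral>\<^sup>+R. ennreal (\<phi> (c + s * R) v) * indicator {T..2*T} R \<partial>lborel) \<le> ennreal (T + M)"
    if "v \<ge> 0" "s = 1 \<or> s = -1" for v s
  proof -
    have "(\<integral>\<^sup>+R. ennreal (\<phi> (c + s * R) v) * indicator {T..2*T} R \<partial>lborel)
       \<le> (\<integral>\<^sup>+R. indicator {T..2*T} R + ennreal (\<phi> (c + s * R) v powr p) \<partial>lborel)"
    proof (rule nn_integral_mono)
      fix R
      have "\<phi> (c + s * R) v \<le> 1 + \<phi> (c + s * R) v powr p"
        using p nonneg by (rule one_plus_powr_ge)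
      then have "ennreal (\<phi> (c + s * R) v) \<le> 1 + ennreal (\<phi> (c + s * R) v powr p)"
        by (metis ennreal_1 ennreal_leI ennreal_plus powr_ge_zero zero_le_one)
      then show "ennreal (\<phi> (c + s * R) v) * indicator {T..2*T} R \<le> indicator {T..2*T} R + ennreal (\<phi> (c + s * R) v powr p)"
        by (auto simp: indicator_def)
    qed
    also have "\<dots> = ennreal T + (\<integral>\<^sup>+R. ennreal (\<phi> (c + s * R) v powr p) \<partial>lborel)"
      using T by (subst nn_integral_add) auto
    also have "(\<integral>\<^sup>+R. ennreal (\<phi> (c + s * R) v powr p) \<partial>lborel) = (\<integral>\<^sup>+u. ennreal (\<phi> u v powr p) \<partial>lborel)"
      using that(2) by (subst (2) nn_integral_real_affine[where t = c and c = s]) auto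
    also have "ennreal T + \<dots> \<le> ennreal T + ennreal M"
      using int[OF that(1)] by (intro add_left_mono)
    finally show ?thesis using T M by simp
  qed
  \<comment> \<open>If no width were good, integrating over \<open>{T..2*T}\<close> would give at
    least \<open>(2 * (T + M) + 1) * T\<close>, whereas exchanging the integrals gives at most
    \<open>2 * (T + M) * T\<close>; the summand 1 makes the contradiction strict.\<close>
  have "ennreal ((2 * (T + M) + 1) * T) = (\<integral>\<^sup>+R. ennreal (2 * (T + M) + 1) * indicator {T..2*T} R \<partial>lborel)"
    using T M by (subst nn_integral_cmult_indicator) (auto simp: ennreal_mult')
  also have "\<dots> \<le> (\<integral>\<^sup>+R. h R * indicator {T..2*T} R \<partial>lborel)"
    using big by (intro nn_integral_mono) (auto simp: indicator_def)
  also have "\<dots> = (\<integral>\<^sup>+R. \<integral>\<^sup>+v. ennreal (\<phi> (c + R) v + \<phi> (c - R) v) * indicator {0..T} v * indicator {T..2*T} R \<partial>lborel \<partial>lborel)"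
    unfolding h_def by (subst nn_integral_multc[symmetric]) auto
  also have "\<dots> = (\<integral>\<^sup>+v. \<integral>\<^sup>+R. ennreal (\<phi> (c + R) v + \<phi> (c - R) v) * indicator {0..T} v * indicator {T..2*T} R \<partial>lborel \<partial>lborel)"
    by (rule lborel_pair.Fubini'[symmetric]) measurable
  also have "\<dots> \<le> (\<integral>\<^sup>+v. ennreal (2 * (T + M)) * indicator {0..T} v \<partial>lborel)"
  proof (rule nn_integral_mono)
    fix v :: real
    have "(\<integral>\<^sup>+R. ennreal (\<phi> (c + R) v + \<phi> (c - R) v) * indicator {0..T} v * indicator {T..2*T} R \<partial>lborel)
       = (\<integral>\<^sup>+R. ennreal (\<phi> (c + 1 * R) v) * indicator {T..2*T} R + ennreal (\<phi> (c + (-1) * R) v) * indicator {T..2*T} R \<partial>lborel) * indicator {0..T} v"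
      using nonneg by (subst nn_integral_multc[symmetric]) (auto intro!: nn_integral_cong simp: indicator_def)
    also have "\<dots> \<le> (ennreal (T + M) + ennreal (T + M)) * indicator {0..T} v"
    proof (cases "v \<ge> 0")
      case True
      then show ?thesis
        using one[of v 1] one[of v "-1"] by (subst nn_integral_add) (auto intro!: mult_right_mono add_mono)
    qed auto
    also have "\<dots> = ennreal (2 * (T + M)) * indicator {0..T} v"
      using T M by (subst ennreal_plus[symmetric]) auto
    finally show "(\<integral>\<^sup>+R. ennreal (\<phi> (c + R) v + \<phi> (c - R) v) * indicator {0..T} v * indicator {T..2*T} R \<partial>lborel)
        \<le> ennreal (2 * (T + M)) * indicator {0..T} v" .
  qed
  also have "\<dots> = ennreal (2 * (T + M) * T)"
    using T M by (subst nn_integral_cmult_indicator) (auto simp: ennreal_mult')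
  finally show False
    using T M by (auto simp: ennreal_le_iff)
qed

text \<open>Only the bottom side, governed by \<open>A\<close>, survives as \<open>T\<close> grows:
  on the other three sides the kernel is of order \<open>1 / T^2\<close>, while the integrals of
  \<open>|F|\<close> are of order \<open>T\<close>.\<close>

lemma half_plane_bound_aux:
  fixes F :: "complex \<Rightarrow> complex"
  assumes F: "F holomorphic_on {w. Im w \<ge> 0}" and p: "p \<ge> 1" and M: "M \<ge> 0" and A: "A \<ge> 0"
    and int: "\<And>y. y \<ge> 0 \<Longrightarrow> (\<integral>\<^sup>+x. ennreal (cmod (F (Complex x y)) powr p) \<partial>lborel) \<le> ennreal M"
    and int0: "(\<integral>\<^sup>+x. ennreal (cmod (F (of_real x)) powr p) \<partial>lborel) \<le> ennreal A"
    and z: "0 < Im z" "Im z \<le> 1" and T: "T \<ge> 2"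
  shows "2 * pi * cmod (F z) \<le> 2 / Im z * (pi + A) + 2 * Im z / T\<^sup>2 * (2 * (T + M) + 1) + 4 * Im z / T\<^sup>2 * (4 * T + M)"
proof -
  \<comment> \<open>Freezing the height at 0 below the real line gives a continuous function on the
    whole plane, as \<open>half_plane_good_width\<close> requires.\<close>
  define \<phi> where "\<phi> = (\<lambda>u v. cmod (F (Complex u (max 0 v))))"
  have contF: "continuous_on {w. Im w \<ge> 0} F"
    using F by (rule holomorphic_on_imp_continuous_on)
  have cont2: "continuous_on UNIV (\<lambda>(u, v). \<phi> u v)"
    unfolding \<phi>_def case_prod_unfold Complex_eq
    by (intro continuous_on_norm continuous_on_compose2[OF contF] continuous_intros) auto
  have contu: "continuous_on UNIV (\<lambda>u. \<phi> u v)" for v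
    using continuous_on_compose2[OF cont2 continuous_on_Pair[OF continuous_on_id continuous_on_const]] by auto
  have contv: "continuous_on UNIV (\<phi> u)" for u
    using continuous_on_compose2[OF cont2 continuous_on_Pair[OF continuous_on_const continuous_on_id]] by auto
  have [measurable]: "(\<lambda>u. \<phi> u v) \<in> borel_measurable borel" "\<phi> u \<in> borel_measurable borel" for u v
    using contu contv by (auto intro!: borel_measurable_continuous_onI)
  have nonneg: "\<phi> u v \<ge> 0" for u v
    by (simp add: \<phi>_def)
  have \<phi>_eq: "\<phi> u v = cmod (F (Complex u v))" if "v \<ge> 0" for u v
    using that by (simp add: \<phi>_def)
  have int': "(\<integral>\<^sup>+u. ennreal (\<phi> u v powr p) \<partial>lborel) \<le> ennreal M" if "v \<ge> 0" for v
    using int[OF that] that by (simp add: \<phi>_eq)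
  obtain R where R: "T \<le> R" "R \<le> 2 * T"
    "(\<integral>\<^sup>+v. ennreal (\<phi> (Re z + R) v + \<phi> (Re z - R) v) * indicator {0..T} v \<partial>lborel) \<le> ennreal (2 * (T + M) + 1)"
    using half_plane_good_width[OF cont2 nonneg p _ M int', of T "Re z"] T by auto
  define k where "k = (\<lambda>w. 2 * \<i> * Im z / ((w - cnj z) * (w - z)))"
  define Q where "Q = (\<lambda>w. F w * k w)"
  have contQ: "continuous_on ({w. Im w \<ge> 0} - {z}) Q"
  proof -
    have "w \<noteq> cnj z" if "Im w \<ge> 0" for w
      using that z by auto
    then show ?thesis
      unfolding Q_def k_def by (intro continuous_intros continuous_on_subset[OF contF]) auto
  qed
  have cQh: "continuous_on S (\<lambda>u. Q (Complex u v))" if "v = 0 \<or> v = T" for v S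
    using that z T by (intro continuous_on_compose2[OF contQ]) (auto simp: complex_eq_iff Complex_eq intro!: continuous_intros)
  have cQv: "continuous_on {0..T} (\<lambda>v. Q (Complex (Re z + s) v))" if "s \<noteq> 0" for s
    using that z T by (intro continuous_on_compose2[OF contQ]) (auto simp: complex_eq_iff Complex_eq intro!: continuous_intros)
  define b1 where "b1 = (\<lambda>u. \<phi> u 0 * (2 / Im z * inverse (1 + (u - Re z)\<^sup>2)))"
  have pos1: "1 + (u - Re z)\<^sup>2 > 0" for u
    by (rule add_pos_nonneg) auto
  have B: "ennreal (cmod (integral {Re z - R..Re z + R} (\<lambda>u. Q (Complex u 0)))) \<le> ennreal (2 / Im z * (pi + A))"
  proof -
    have "ennreal (cmod (integral {Re z - R..Re z + R} (\<lambda>u. Q (Complex u 0))))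
        \<le> (\<integral>\<^sup>+u. ennreal (b1 u) * indicator {Re z - R..Re z + R} u \<partial>lborel)"
    proof (rule norm_integral_le_nn_integral)
      show "continuous_on UNIV b1"
        unfolding b1_def using z by (auto intro!: continuous_intros contu simp: pos1[THEN less_imp_neq, symmetric])
      show "cmod (Q (Complex u 0)) \<le> b1 u" for u
      proof -
        have "Complex u 0 = of_real u" by (simp add: complex_of_real_def)
        then have "cmod (Q (Complex u 0)) = \<phi> u 0 * cmod (k (of_real u))"
          by (simp add: Q_def \<phi>_eq norm_mult)
        also have "\<dots> \<le> b1 u"
          unfolding b1_def k_def by (intro mult_left_mono half_plane_kernel_bounds(1) z nonneg)
        finally show ?thesis .
      qed
      show "b1 u \<ge> 0" for u
        using pos1[of u] z by (auto simp: b1_def nonneg)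
    qed (rule cQh, simp)
    also have "\<dots> \<le> (\<integral>\<^sup>+u. ennreal (2 / Im z) * (ennreal (inverse (1 + (u - Re z)\<^sup>2)) + ennreal (cmod (F (of_real u)) powr p)) \<partial>lborel)"
    proof (rule nn_integral_mono)
      fix u
      \<comment> \<open>In \<open>1 + \<phi> u 0 powr p\<close> the weight is kept with the summand
        1, where it integrates to \<open>pi\<close>, and is bounded by 1 in front of the
        power.\<close>
      have "inverse (1 + (u - Re z)\<^sup>2) \<le> 1"
        by (rule inverse_le_1_iff[THEN iffD2]) auto
      moreover have "inverse (1 + (u - Re z)\<^sup>2) \<ge> 0"
        using pos1[of u] by simp
      moreover have "\<phi> u 0 \<le> 1 + \<phi> u 0 powr p"
        using p nonneg by (rule one_plus_powr_ge)
      ultimately have "\<phi> u 0 * inverse (1 + (u - Re z)\<^sup>2) \<le> inverse (1 + (u - Re z)\<^sup>2) + \<phi> u 0 powr p"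
        using mult_right_mono[of "\<phi> u 0" "1 + \<phi> u 0 powr p" "inverse (1 + (u - Re z)\<^sup>2)"]
          mult_left_le[of "inverse (1 + (u - Re z)\<^sup>2)" "\<phi> u 0 powr p"]
        by (simp add: algebra_simps)
      then have "b1 u \<le> 2 / Im z * (inverse (1 + (u - Re z)\<^sup>2) + \<phi> u 0 powr p)"
        unfolding b1_def mult.left_commute[of "\<phi> u 0"] using z by (intro mult_left_mono) auto
      also have "\<phi> u 0 = cmod (F (of_real u))"
        by (simp add: \<phi>_eq complex_of_real_def)
      finally have "ennreal (b1 u) \<le> ennreal (2 / Im z * (inverse (1 + (u - Re z)\<^sup>2) + cmod (F (of_real u)) powr p))"
        by (rule ennreal_leI)
      also have "\<dots> = ennreal (2 / Im z) * (ennreal (inverse (1 + (u - Re z)\<^sup>2)) + ennreal (cmod (F (of_real u)) powr p))"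
        using z pos1[of u] by (subst ennreal_mult) auto
      finally show "ennreal (b1 u) * indicator {Re z - R..Re z + R} u \<le> \<dots>"
        by (auto simp: indicator_def)
    qed
    also have "\<dots> = ennreal (2 / Im z) * (ennreal pi + (\<integral>\<^sup>+u. ennreal (cmod (F (of_real u)) powr p) \<partial>lborel))"
    proof -
      have [measurable]: "(\<lambda>u. cmod (F (complex_of_real u))) \<in> borel_measurable borel"
        using \<open>\<And>v. (\<lambda>u. \<phi> u v) \<in> borel_measurable borel\<close>[of 0] by (simp add: \<phi>_eq complex_of_real_def)
      show ?thesis
        by (subst nn_integral_cmult, measurable, subst nn_integral_add) 
           (auto simp: nn_integral_inverse_1_plus_square)
    qed
    also have "\<dots> \<le> ennreal (2 / Im z) * (ennreal pi + ennreal A)"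
      using int0 by (intro mult_left_mono add_left_mono) auto
    also have "\<dots> = ennreal (2 / Im z * (pi + A))"
      using A z by (subst ennreal_mult) auto
    finally show ?thesis .
  qed
  have Tp: "ennreal (cmod (integral {Re z - R..Re z + R} (\<lambda>u. Q (Complex u T)))) \<le> ennreal (4 * Im z / T\<^sup>2 * (4 * T + M))"
  proof -
    have "ennreal (cmod (integral {Re z - R..Re z + R} (\<lambda>u. Q (Complex u T))))
        \<le> (\<integral>\<^sup>+u. ennreal (\<phi> u T * (4 * Im z / T\<^sup>2)) * indicator {Re z - R..Re z + R} u \<partial>lborel)"
    proof (rule norm_integral_le_nn_integral)
      show "continuous_on UNIV (\<lambda>u. \<phi> u T * (4 * Im z / T\<^sup>2))"
        using T by (auto intro!: continuous_intros contu)
      show "cmod (Q (Complex u T)) \<le> \<phi> u T * (4 * Im z / T\<^sup>2)" for u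
      proof -
        have "cmod (Q (Complex u T)) = \<phi> u T * cmod (k (Complex u T))"
          using T by (simp add: Q_def \<phi>_eq norm_mult)
        also have "\<dots> \<le> \<phi> u T * (4 * Im z / T\<^sup>2)"
          unfolding k_def by (intro mult_left_mono half_plane_kernel_bounds(3) z T nonneg) simp
        finally show ?thesis .
      qed
    qed (use cQh z nonneg in auto)
    also have "\<dots> \<le> (\<integral>\<^sup>+u. ennreal (4 * Im z / T\<^sup>2) * (indicator {Re z - R..Re z + R} u + ennreal (\<phi> u T powr p)) \<partial>lborel)"
    proof (rule nn_integral_mono)
      fix u
      have "\<phi> u T * (4 * Im z / T\<^sup>2) \<le> 4 * Im z / T\<^sup>2 * (1 + \<phi> u T powr p)"
        using mult_left_mono[OF one_plus_powr_ge[OF p nonneg[of u T]], of "4 * Im z / T\<^sup>2"] z by (simp add: mult.commute)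
      then have "ennreal (\<phi> u T * (4 * Im z / T\<^sup>2)) \<le> ennreal (4 * Im z / T\<^sup>2 * (1 + \<phi> u T powr p))"
        by (rule ennreal_leI)
      also have "\<dots> = ennreal (4 * Im z / T\<^sup>2) * (1 + ennreal (\<phi> u T powr p))"
        using z by (subst ennreal_mult) auto
      finally show "ennreal (\<phi> u T * (4 * Im z / T\<^sup>2)) * indicator {Re z - R..Re z + R} u
        \<le> ennreal (4 * Im z / T\<^sup>2) * (indicator {Re z - R..Re z + R} u + ennreal (\<phi> u T powr p))"
        by (auto simp: indicator_def)
    qed
    also have "\<dots> = ennreal (4 * Im z / T\<^sup>2) * (ennreal (2 * R) + (\<integral>\<^sup>+u. ennreal (\<phi> u T powr p) \<partial>lborel))"
      using R T by (subst nn_integral_cmult, measurable, subst nn_integral_add) auto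
    also have "\<dots> \<le> ennreal (4 * Im z / T\<^sup>2) * (ennreal (4 * T) + ennreal M)"
      using int'[of T] T R by (intro mult_left_mono add_mono) (auto intro!: ennreal_leI)
    also have "\<dots> = ennreal (4 * Im z / T\<^sup>2 * (4 * T + M))"
      using M z T by (subst ennreal_mult) auto
    finally show ?thesis .
  qed
  have side: "ennreal (cmod (integral {0..T} (\<lambda>v. Q (Complex (Re z + s) v))))
      \<le> ennreal (2 * Im z / T\<^sup>2) * (\<integral>\<^sup>+v. ennreal (\<phi> (Re z + s) v) * indicator {0..T} v \<partial>lborel)" if "\<bar>s\<bar> = R" for s
  proof -
    have "ennreal (cmod (integral {0..T} (\<lambda>v. Q (Complex (Re z + s) v))))
       \<le> (\<integral>\<^sup>+v. ennreal (2 * Im z / T\<^sup>2 * \<phi> (Re z + s) v) * indicator {0..T} v \<partial>lborel)"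
    proof (rule norm_integral_le_nn_integral)
      show "continuous_on {0..T} (\<lambda>v. Q (Complex (Re z + s) v))"
        using that R T by (intro cQv) auto
      show "continuous_on UNIV (\<lambda>v. 2 * Im z / T\<^sup>2 * \<phi> (Re z + s) v)"
        using T by (auto intro!: continuous_intros contv)
      show "cmod (Q (Complex (Re z + s) v)) \<le> 2 * Im z / T\<^sup>2 * \<phi> (Re z + s) v" if v: "v \<in> {0..T}" for v
      proof -
        have "cmod (Q (Complex (Re z + s) v)) = cmod (k (Complex (Re z + s) v)) * \<phi> (Re z + s) v"
          using v by (simp add: Q_def \<phi>_eq norm_mult)
        also have "\<dots> \<le> 2 * Im z / T\<^sup>2 * \<phi> (Re z + s) v"
          unfolding k_def using T R \<open>\<bar>s\<bar> = R\<close>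
          by (intro mult_right_mono half_plane_kernel_bounds(2) z nonneg) auto
        finally show ?thesis .
      qed
    qed (use z nonneg in auto)
    also have "\<dots> = ennreal (2 * Im z / T\<^sup>2) * (\<integral>\<^sup>+v. ennreal (\<phi> (Re z + s) v) * indicator {0..T} v \<partial>lborel)"
      using z nonneg by (subst nn_integral_cmult[symmetric])
        (auto intro!: nn_integral_cong simp: indicator_def ennreal_mult[symmetric])
    finally show ?thesis .
  qed
  have sides: "ennreal (cmod (integral {0..T} (\<lambda>v. Q (Complex (Re z + R) v)))) + ennreal (cmod (integral {0..T} (\<lambda>v. Q (Complex (Re z - R) v))))
     \<le> ennreal (2 * Im z / T\<^sup>2 * (2 * (T + M) + 1))"
  proof -
    have "ennreal (cmod (integral {0..T} (\<lambda>v. Q (Complex (Re z + R) v)))) + ennreal (cmod (integral {0..T} (\<lambda>v. Q (Complex (Re z - R) v))))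
      \<le> ennreal (2 * Im z / T\<^sup>2) * (\<integral>\<^sup>+v. ennreal (\<phi> (Re z + R) v) * indicator {0..T} v \<partial>lborel)
       + ennreal (2 * Im z / T\<^sup>2) * (\<integral>\<^sup>+v. ennreal (\<phi> (Re z - R) v) * indicator {0..T} v \<partial>lborel)"
      using side[of R] side[of "-R"] R T by (intro add_mono) auto
    also have "\<dots> = ennreal (2 * Im z / T\<^sup>2) * (\<integral>\<^sup>+v. ennreal (\<phi> (Re z + R) v + \<phi> (Re z - R) v) * indicator {0..T} v \<partial>lborel)"
      using nonneg by (subst distrib_left[symmetric], subst nn_integral_add[symmetric])
        (auto simp: distrib_right)
    also have "\<dots> \<le> ennreal (2 * Im z / T\<^sup>2) * ennreal (2 * (T + M) + 1)"
      using R(3) by (intro mult_left_mono) auto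
    also have "\<dots> = ennreal (2 * Im z / T\<^sup>2 * (2 * (T + M) + 1))"
      using M z T by (subst ennreal_mult) auto
    finally show ?thesis .
  qed
  have "2 * pi * cmod (F z) \<le> cmod (integral {Re z - R..Re z + R} (\<lambda>u. Q (Complex u 0)))
     + cmod (integral {Re z - R..Re z + R} (\<lambda>u. Q (Complex u T)))
     + cmod (integral {0..T} (\<lambda>v. Q (Complex (Re z + R) v)))
     + cmod (integral {0..T} (\<lambda>v. Q (Complex (Re z - R) v)))"
    unfolding Q_def k_def using z T R by (intro half_plane_rectangle_formula[OF F]) auto
  moreover have "cmod (integral {Re z - R..Re z + R} (\<lambda>u. Q (Complex u 0))) \<le> 2 / Im z * (pi + A)"
    using B z A by (subst (asm) ennreal_le_iff) auto
  moreover have "cmod (integral {Re z - R..Re z + R} (\<lambda>u. Q (Complex u T))) \<le> 4 * Im z / T\<^sup>2 * (4 * T + M)"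
    using Tp z M T by (subst (asm) ennreal_le_iff) auto
  moreover have "cmod (integral {0..T} (\<lambda>v. Q (Complex (Re z + R) v))) + cmod (integral {0..T} (\<lambda>v. Q (Complex (Re z - R) v)))
      \<le> 2 * Im z / T\<^sup>2 * (2 * (T + M) + 1)"
    using sides z M T by (simp flip: ennreal_plus)
  ultimately show ?thesis by linarith
qed

text \<open>Division by \<open>s\<close> makes the boundary integral at most 1, and letting
  \<open>T\<close> tend to infinity removes \<open>M\<close>: the bound uniform in the height
  matters only through its finiteness, and the constant depends on the boundary values
  alone.\<close>

lemma half_plane_bound:
  fixes F :: "complex \<Rightarrow> complex"
  assumes F: "F holomorphic_on {w. Im w \<ge> 0}" and p: "p \<ge> 1" and s: "s > 0" 
    and int: "\<And>y. y \<ge> 0 \<Longrightarrow> (\<integral>\<^sup>+x. ennreal (cmod (F (Complex x y)) powr p) \<partial>lborel) \<le> ennreal M"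
    and int0: "(\<integral>\<^sup>+x. ennreal (cmod (F (of_real x)) powr p) \<partial>lborel) \<le> ennreal (s powr p)"
    and z: "0 < Im z" "Im z \<le> 1"
  shows "cmod (F z) \<le> 2 * s / Im z"
proof -
  define G where "G = (\<lambda>w. F w / of_real s)"
  define N where "N = max 0 M / s powr p"
  have N: "N \<ge> 0" by (simp add: N_def)
  have G: "G holomorphic_on {w. Im w \<ge> 0}"
    unfolding G_def using F s by (intro holomorphic_intros) auto
  have contF: "continuous_on {w. Im w \<ge> 0} F"
    using F by (rule holomorphic_on_imp_continuous_on)
  have [measurable]: "(\<lambda>x. cmod (F (Complex x y))) \<in> borel_measurable borel" if "y \<ge> 0" for y
    by (intro borel_measurable_continuous_onI continuous_on_norm continuous_on_compose2[OF contF])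
       (use that in \<open>auto simp: Complex_eq intro!: continuous_intros\<close>)
  have scale: "(\<integral>\<^sup>+x. ennreal (cmod (G (Complex x y)) powr p) \<partial>lborel)
     = (\<integral>\<^sup>+x. ennreal (cmod (F (Complex x y)) powr p) \<partial>lborel) * ennreal (1 / s powr p)" if "y \<ge> 0" for y
    using s that by (subst nn_integral_multc[symmetric])
      (auto simp: G_def norm_divide powr_divide ennreal_mult[symmetric])
  have 1: "(\<integral>\<^sup>+x. ennreal (cmod (G (Complex x y)) powr p) \<partial>lborel) \<le> ennreal N" if "y \<ge> 0" for y
  proof -
    have "(\<integral>\<^sup>+x. ennreal (cmod (F (Complex x y)) powr p) \<partial>lborel) \<le> ennreal (max 0 M)"
      using int[OF that] by (rule order_trans) (auto intro: ennreal_leI)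
    then have "(\<integral>\<^sup>+x. ennreal (cmod (G (Complex x y)) powr p) \<partial>lborel) \<le> ennreal (max 0 M) * ennreal (1 / s powr p)"
      unfolding scale[OF that] by (rule mult_right_mono) auto
    then show ?thesis by (simp add: N_def ennreal_mult[symmetric])
  qed
  have 2: "(\<integral>\<^sup>+x. ennreal (cmod (G (of_real x)) powr p) \<partial>lborel) \<le> ennreal 1"
  proof -
    have "(\<integral>\<^sup>+x. ennreal (cmod (G (Complex x 0)) powr p) \<partial>lborel) \<le> ennreal (s powr p) * ennreal (1 / s powr p)"
      unfolding scale[OF order_refl] using int0 by (intro mult_right_mono) (auto simp: complex_of_real_def)
    then show ?thesis using s by (simp add: complex_of_real_def ennreal_mult[symmetric])
  qed
  define c where "c = 2 / Im z * (pi + 1)"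
  have "2 * pi * cmod (G z) \<le> c"
  proof (rule tendsto_lowerbound)
    show "((\<lambda>T. c + 2 * Im z / T\<^sup>2 * (2 * (T + N) + 1) + 4 * Im z / T\<^sup>2 * (4 * T + N)) \<longlongrightarrow> c) at_top"
      by real_asymp
    show "\<forall>\<^sub>F T in at_top. 2 * pi * cmod (G z) \<le> c + 2 * Im z / T\<^sup>2 * (2 * (T + N) + 1) + 4 * Im z / T\<^sup>2 * (4 * T + N)"
      using eventually_ge_at_top[of "2::real"] unfolding c_def
      by eventually_elim (use half_plane_bound_aux[OF G p N _ 1 2 z] in auto)
  qed simp
  \<comment> \<open>From \<open>pi + 1 \<le> 2 * pi\<close>; the factor \<open>2 * pi\<close> of
    Cauchy's formula then cancels.\<close>
  also have "c \<le> 4 * pi / Im z"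
    using z pi_ge_two by (simp add: c_def divide_right_mono)
  finally have "2 * pi * cmod (G z) \<le> 2 * pi * (2 / Im z)"
    by simp
  then have "cmod (G z) \<le> 2 / Im z"
    by (subst (asm) mult_le_cancel_left_pos) auto
  then show ?thesis using s by (simp add: G_def norm_divide field_simps)
qed

text \<open>Fatou's lemma along the heights \<open>1 / (n + 1)\<close>; continuity up to the real
  line gives pointwise convergence.\<close>

lemma Fatou_real_line:
  fixes F :: "complex \<Rightarrow> complex"
  assumes F: "continuous_on {w. Im w \<ge> 0} F" and p: "p > 0"
    and int: "\<And>y. y > 0 \<Longrightarrow> (\<integral>\<^sup>+x. ennreal (cmod (F (Complex x y)) powr p) \<partial>lborel) \<le> M"
  shows "(\<integral>\<^sup>+x. ennreal (cmod (F (of_real x)) powr p) \<partial>lborel) \<le> M"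
proof -
  define u where "u = (\<lambda>n x. ennreal (cmod (F (Complex x (1 / real (Suc n)))) powr p))"
  have [measurable]: "(\<lambda>x. cmod (F (Complex x y))) \<in> borel_measurable borel" if "y \<ge> 0" for y
    by (intro borel_measurable_continuous_onI continuous_on_norm continuous_on_compose2[OF F])
       (use that in \<open>auto simp: Complex_eq intro!: continuous_intros\<close>)
  have "(\<lambda>n. u n x) \<longlonglongrightarrow> ennreal (cmod (F (of_real x)) powr p)" for x
  proof -
    have "((\<lambda>n. Complex x (1 / real (Suc n))) \<longlongrightarrow> Complex x 0) sequentially"
      by (intro tendsto_intros LIMSEQ_Suc[OF lim_1_over_n])
    then have "(\<lambda>n. F (Complex x (1 / real (Suc n)))) \<longlonglongrightarrow> F (of_real x)"
      using F by (intro continuous_on_tendsto_compose[OF F]) (auto simp: complex_of_real_def)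
    then show ?thesis
      unfolding u_def using p by (intro tendsto_ennrealI tendsto_powr' tendsto_norm) auto
  qed
  then have "liminf (\<lambda>n. u n x) = ennreal (cmod (F (of_real x)) powr p)" for x
    by (intro lim_imp_Liminf) auto
  then have "(\<integral>\<^sup>+x. ennreal (cmod (F (of_real x)) powr p) \<partial>lborel) = (\<integral>\<^sup>+x. liminf (\<lambda>n. u n x) \<partial>lborel)"
    by simp
  also have "\<dots> \<le> liminf (\<lambda>n. \<integral>\<^sup>+x. u n x \<partial>lborel)"
    unfolding u_def by (intro nn_integral_liminf) simp
  also have "\<dots> \<le> liminf (\<lambda>n::nat. M)"
    unfolding u_def by (intro Liminf_mono always_eventually allI int) auto
  also have "\<dots> = M" by (intro Liminf_const) simp
  finally show ?thesis .
qed

section \<open>A maximum principle near the real line\<close>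

lemma power_bounded_imp_le:
  fixes a b K :: real
  assumes "a \<ge> 0" "b > 0" "\<And>n. a ^ n \<le> K * b ^ n"
  shows "a \<le> b"
proof (rule ccontr)
  assume "\<not> a \<le> b"
  then have "a / b > 1" using assms by simp
  then obtain n where "K < (a / b) ^ n" using real_arch_pow by blast
  then show False using assms(2) assms(3)[of n] by (simp add: power_divide field_simps)
qed

text \<open>The half-plane bound is applied to the powers of \<open>D\<close>, made integrable by one fixed factor;
  the constant it loses disappears after taking \<open>n\<close>-th roots.\<close>
lemma strip_maximum_principle:
  fixes D :: "complex \<Rightarrow> complex"
  assumes D: "D holomorphic_on {w. Im w \<ge> 0}" and B: "\<And>w. Im w \<ge> 0 \<Longrightarrow> cmod (D w) \<le> B"
    and M: "M > 0" "\<And>x. cmod (D (of_real x)) \<le> M"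
    and z: "0 < Im z" "Im z \<le> 1"
  shows "cmod (D z) \<le> M"
proof (rule power_bounded_imp_le)
  fix n
  \<comment> \<open>Inverse square decay makes \<open>G\<close> integrable on horizontal lines, so
    that exponent 1 can be used; the pole \<open>- \<i>\<close> lies outside the closed upper
    half-plane.\<close>
  define G where "G = (\<lambda>w. D w ^ n / (w + \<i>)\<^sup>2)"
  have B0: "B \<ge> 0" using order_trans[OF norm_ge_zero B[of 0]] by simp
  have nz: "w + \<i> \<noteq> 0" if "Im w \<ge> 0" for w
    using that by (auto simp: complex_eq_iff)
  have G: "G holomorphic_on {w. Im w \<ge> 0}"
    unfolding G_def using nz by (auto intro!: holomorphic_intros D)
  have bnd: "(\<integral>\<^sup>+x. ennreal (cmod (G (Complex x y)) powr 1) \<partial>lborel) \<le> ennreal (pi * C ^ n)"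
    if y: "y \<ge> 0" and C: "C \<ge> 0" "\<And>x. cmod (D (Complex x y)) \<le> C" for y C
  proof -
    have "(\<integral>\<^sup>+x. ennreal (cmod (G (Complex x y)) powr 1) \<partial>lborel) \<le> (\<integral>\<^sup>+x. ennreal (C ^ n) * ennreal (inverse (1 + (x - 0)\<^sup>2)) \<partial>lborel)"
    proof (rule nn_integral_mono)
      fix x :: real
      have pos: "1 + x\<^sup>2 > 0" by (rule add_pos_nonneg) auto
      have "(cmod (Complex x y + \<i>))\<^sup>2 = x\<^sup>2 + (y + 1)\<^sup>2"
        by (simp add: cmod_power2)
      also have "\<dots> \<ge> 1 + x\<^sup>2"
        using y by (simp add: power2_eq_square algebra_simps)
      finally have "cmod (G (Complex x y)) \<le> C ^ n / (1 + x\<^sup>2)"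
        unfolding G_def norm_divide norm_power using C pos
        by (intro frac_le power_mono) auto
      then show "ennreal (cmod (G (Complex x y)) powr 1) \<le> ennreal (C ^ n) * ennreal (inverse (1 + (x - 0)\<^sup>2))"
        using C by (subst ennreal_mult[symmetric]) (auto intro!: ennreal_leI simp: divide_inverse)
    qed
    also have "\<dots> = ennreal (pi * C ^ n)"
      using C nn_integral_inverse_1_plus_square[of 0]
      by (subst nn_integral_cmult) (auto simp: ennreal_mult mult.commute)
    finally show ?thesis .
  qed
  have "cmod (G z) \<le> 2 * (pi * M ^ n) / Im z"
  proof (rule half_plane_bound[OF G order_refl])
    show "pi * M ^ n > 0" using M by simp
    show "(\<integral>\<^sup>+x. ennreal (cmod (G (Complex x y)) powr 1) \<partial>lborel) \<le> ennreal (pi * B ^ n)" if "y \<ge> 0" for y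
      using that B B0 by (intro bnd) auto
    show "(\<integral>\<^sup>+x. ennreal (cmod (G (of_real x)) powr 1) \<partial>lborel) \<le> ennreal ((pi * M ^ n) powr 1)"
      using bnd[of 0 M] M by (simp add: complex_of_real_def)
  qed (use z in auto)
  then show "cmod (D z) ^ n \<le> (2 * pi * (cmod (z + \<i>))\<^sup>2 / Im z) * M ^ n"
    using nz[of z] z by (simp add: G_def norm_divide norm_power field_simps)
qed (use M in auto)

section \<open>Hermite--Biehler functions with bounded phase derivative\<close>

lemma sharp_holomorphic: "E holomorphic_on UNIV \<Longrightarrow> sharp E holomorphic_on UNIV"
  unfolding sharp_def
  using holomorphic_on_compose_cnj_cnj[of E UNIV] by (auto simp: o_def intro: holomorphic_on_subset)

lemma sharp_sharp [simp]: "sharp (sharp f) = f"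
  by (simp add: sharp_def)

lemma norm_sharp_real [simp]: "cmod (sharp f (of_real x)) = cmod (f (of_real x))"
  by (simp add: sharp_def)

lemma hermite_biehler_nonzero:
  assumes "hermite_biehler E" "\<forall>x::real. E (of_real x) \<noteq> 0" "Im z \<ge> 0"
  shows "E z \<noteq> 0"
proof (cases "Im z = 0")
  case True
  then show ?thesis using assms(2) by (metis complex_is_Real_iff of_real_Re)
next
  case False
  then have "cmod (E (cnj z)) < cmod (E z)"
    using assms by (auto simp: hermite_biehler_def)
  then show ?thesis by (auto simp: norm_ge_zero not_less)
qed

lemma hermite_biehler_sharp_le:
  assumes "hermite_biehler E" "Im z \<ge> 0"
  shows "cmod (sharp E z) \<le> cmod (E z)"
proof (cases "Im z = 0")
  case True
  then show ?thesis by (metis norm_sharp_real complex_is_Real_iff of_real_Re order_refl)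
next
  case False
  then show ?thesis
    using assms by (auto simp: hermite_biehler_def sharp_def less_imp_le)
qed

text \<open>Differentiate \<open>\<Theta> x = exp (\<i> * \<phi> x)\<close> along the real line; the
  exponential has modulus 1 because \<open>\<phi>\<close> is real.\<close>

lemma phase_function_deriv:
  assumes E: "hermite_biehler E" "\<forall>x::real. E (of_real x) \<noteq> 0" and ph: "phase_function E \<phi>"
  shows "cmod (deriv (\<lambda>w. sharp E w / E w) (of_real x)) = \<bar>deriv \<phi> x\<bar>"
proof -
  define \<Theta> where "\<Theta> = (\<lambda>w. sharp E w / E w)"
  have holE: "E holomorphic_on UNIV" using E by (simp add: hermite_biehler_def)
  have "\<Theta> field_differentiable (at (of_real x))"
    unfolding \<Theta>_def using holE sharp_holomorphic[OF holE] E(2)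
    by (intro derivative_intros) (auto simp: holomorphic_on_def)
  then have "(\<Theta> has_field_derivative deriv \<Theta> (of_real x)) (at (of_real x))"
    by (simp add: DERIV_deriv_iff_field_differentiable)
  then have 1: "((\<lambda>t. \<Theta> (of_real t)) has_vector_derivative deriv \<Theta> (of_real x)) (at x)"
    by (rule has_vector_derivative_real_field)
  have "(\<phi> has_real_derivative deriv \<phi> x) (at x)"
    using ph by (auto simp: phase_function_def DERIV_deriv_iff_real_differentiable)
  then have "((\<lambda>t. complex_of_real (\<phi> t)) has_vector_derivative of_real (deriv \<phi> x)) (at x)"
    by (intro has_vector_derivative_of_real) (simp add: has_real_derivative_iff_has_vector_derivative)
  then have "((\<lambda>t. \<i> * of_real (\<phi> t)) has_vector_derivative \<i> * of_real (deriv \<phi> x)) (at x)"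
    by (rule has_vector_derivative_mult_right)
  from field_vector_diff_chain_at[OF this DERIV_exp]
  have "((\<lambda>t. exp (\<i> * of_real (\<phi> t))) has_vector_derivative \<i> * of_real (deriv \<phi> x) * exp (\<i> * of_real (\<phi> x))) (at x)"
    by (simp add: o_def)
  moreover have "(\<lambda>t. exp (\<i> * of_real (\<phi> t))) = (\<lambda>t. \<Theta> (of_real t))"
    using ph by (simp add: phase_function_def \<Theta>_def)
  ultimately have "deriv \<Theta> (of_real x) = \<i> * of_real (deriv \<phi> x) * exp (\<i> * of_real (\<phi> x))"
    using 1 vector_derivative_unique_at by metis
  then show ?thesis by (simp add: \<Theta>_def norm_mult)
qed

text \<open>The set where \<open>f\<close> exceeds \<open>M\<close> is open and null, hence empty.
  This makes the essential bound on the phase derivative a pointwise bound on the derivative of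
  \<open>\<Theta>\<close>.\<close>

lemma AE_lborel_continuous_le:
  fixes f :: "real \<Rightarrow> real"
  assumes "AE x in lborel. f x \<le> M" "continuous_on UNIV f"
  shows "f x \<le> M"
proof (rule ccontr)
  assume "\<not> f x \<le> M"
  then have "x \<in> f -` {M<..}" by simp
  moreover have op: "open (f -` {M<..})"
    using assms(2) by (intro open_vimage) auto
  ultimately have "f -` {M<..} \<notin> null_sets lborel"
    using open_not_negligible[OF op] by (auto simp: negligible_iff_null_sets intro: null_sets_completionI)
  moreover have "f -` {M<..} \<in> null_sets lborel"
    using assms(1) op AE_iff_null_sets[of "f -` {M<..}" lborel] by (auto simp: not_less elim: eventually_mono)
  ultimately show False by contradiction
qed

text \<open>The derivative of \<open>\<Theta>\<close> is bounded by \<open>M\<close> on the real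
  line, and the maximum principle carries this bound into the strip. As \<open>\<Theta>\<close> has
  modulus 1 on the real line, its modulus drops by at most \<open>M * Im z\<close> on the way up to
  \<open>z\<close>.\<close>

lemma phase_quotient_lower_bound:
  assumes E: "hermite_biehler E" "\<forall>x::real. E (of_real x) \<noteq> 0" and ph: "phase_function E \<phi>"
    and M: "AE x in lborel. \<bar>deriv \<phi> x\<bar> \<le> M" "M > 0" and z: "0 \<le> Im z" "Im z \<le> 1"
  shows "cmod (sharp E z / E z) \<ge> 1 - M * Im z"
proof -
  define \<Theta> where "\<Theta> = (\<lambda>w. sharp E w / E w)"
  define V where "V = {w. E w \<noteq> 0}"
  have holE: "E holomorphic_on UNIV" using E by (simp add: hermite_biehler_def)
  have "open (E -` (- {0}))"
    using holE by (intro open_vimage holomorphic_on_imp_continuous_on) auto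
  then have V: "open V"
    by (simp add: V_def vimage_def)
  have UV: "w \<in> V" if "Im w \<ge> 0" for w
    using hermite_biehler_nonzero[OF E that] by (simp add: V_def)
  have hol: "\<Theta> holomorphic_on V"
    unfolding \<Theta>_def V_def 
    by (intro holomorphic_intros holomorphic_on_subset[OF holE] holomorphic_on_subset[OF sharp_holomorphic[OF holE]]) auto
  have der: "(\<Theta> has_field_derivative deriv \<Theta> w) (at w within S)" if "Im w \<ge> 0" for w S
    using holomorphic_derivI[OF hol V UV[OF that]] by (rule has_field_derivative_at_within)
  have le1: "cmod (\<Theta> w) \<le> 1" if "Im w \<ge> 0" for w
    using hermite_biehler_sharp_le[OF E(1) that] by (auto simp: \<Theta>_def norm_divide divide_le_eq_1)
  have derR: "cmod (deriv \<Theta> (of_real x)) \<le> M" for x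
  proof (rule AE_lborel_continuous_le[where f = "\<lambda>x. cmod (deriv \<Theta> (of_real x))"])
    show "AE x in lborel. cmod (deriv \<Theta> (of_real x)) \<le> M"
      using M(1) phase_function_deriv[OF E ph] by (simp add: \<Theta>_def)
    show "continuous_on UNIV (\<lambda>x. cmod (deriv \<Theta> (of_real x)))"
      by (intro continuous_on_norm continuous_on_compose2[OF holomorphic_on_imp_continuous_on[OF holomorphic_deriv[OF hol V]]])
        (auto intro!: continuous_intros UV)
  qed
  have lipR: "cmod (\<Theta> (of_real a) - \<Theta> (of_real b)) \<le> M * \<bar>a - b\<bar>" for a b :: real
  proof -
    have "cmod (\<Theta> (of_real a) - \<Theta> (of_real b)) \<le> M * cmod (complex_of_real a - of_real b)"
    proof (rule field_differentiable_bound[where f = \<Theta> and f' = "deriv \<Theta>" and S = "range of_real"])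
      show "convex (range complex_of_real)"
        by (intro convex_linear_image) auto
      show "(\<Theta> has_field_derivative deriv \<Theta> w) (at w within range of_real)" if "w \<in> range of_real" for w
        using that by (intro der) auto
      show "cmod (deriv \<Theta> w) \<le> M" if "w \<in> range of_real" for w
        using that derR by auto
    qed auto
    then show ?thesis by (simp flip: of_real_diff)
  qed
  \<comment> \<open>The maximum principle needs a bounded function. Difference quotients of
    \<open>\<Theta>\<close> are bounded by \<open>2 / h\<close>, whereas no bound on the derivative
    in the half-plane is known beforehand.\<close>
  have lipU: "cmod (\<Theta> (w + of_real h) - \<Theta> w) \<le> M * h" if "h > 0" "0 < Im w" "Im w \<le> 1" for w h
  proof -
    define D where "D = (\<lambda>w. (\<Theta> (w + of_real h) - \<Theta> w) / of_real h)"
    have "cmod (D w) \<le> M"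
    proof (rule strip_maximum_principle[where D = D and B = "2 / h"])
      show "D holomorphic_on {w. Im w \<ge> 0}"
      proof -
        have "(\<lambda>w. \<Theta> (w + of_real h)) holomorphic_on {w. Im w \<ge> 0}"
          by (rule holomorphic_on_compose_gen[OF _ hol, unfolded o_def])
            (use UV in \<open>auto intro!: holomorphic_intros\<close>)
        then show ?thesis
          unfolding D_def using that(1) UV
          by (intro holomorphic_intros holomorphic_on_subset[OF hol]) auto
      qed
      show "cmod (D w) \<le> 2 / h" if "Im w \<ge> 0" for w
      proof -
        have "cmod (\<Theta> (w + of_real h) - \<Theta> w) \<le> 1 + 1"
          using that by (intro norm_triangle_le_diff add_mono le1) auto
        then show ?thesis using \<open>h > 0\<close> by (simp add: D_def norm_divide divide_right_mono)
      qed
      show "cmod (D (of_real x)) \<le> M" for x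
        using lipR[of "x + h" x] \<open>h > 0\<close> by (simp add: D_def norm_divide field_simps)
    qed (use that M in auto)
    then show ?thesis using that(1) by (simp add: D_def norm_divide field_simps)
  qed
  have derU: "cmod (deriv \<Theta> w) \<le> M" if w: "0 \<le> Im w" "Im w \<le> 1" for w
  proof (cases "Im w = 0")
    case True
    then show ?thesis using derR[of "Re w"] by (metis complex_is_Real_iff of_real_Re)
  next
    case False
    \<comment> \<open>The complex derivative is recovered from the horizontal increments
      \<open>1 / (n + 1)\<close> alone, to which \<open>lipU\<close> applies.\<close>
    have "((\<lambda>h. (\<Theta> (w + h) - \<Theta> w) / h) \<longlongrightarrow> deriv \<Theta> w) (at 0)"
      using der[OF w(1), of UNIV] by (simp add: DERIV_def)
    moreover have "1 + complex_of_nat n \<noteq> 0" for n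
      by (metis of_nat_Suc of_nat_eq_0_iff nat.distinct(1))
    then have "filterlim (\<lambda>n. complex_of_real (1 / real (Suc n))) (at 0) sequentially"
      unfolding filterlim_at using tendsto_of_real[OF LIMSEQ_Suc[OF lim_1_over_n[where 'a=real]], where 'a=complex] by auto
    ultimately have "(\<lambda>n. (\<Theta> (w + of_real (1 / real (Suc n))) - \<Theta> w) / of_real (1 / real (Suc n))) \<longlonglongrightarrow> deriv \<Theta> w"
      by (rule filterlim_compose)
    then have "(\<lambda>n. cmod ((\<Theta> (w + of_real (1 / real (Suc n))) - \<Theta> w) / of_real (1 / real (Suc n)))) \<longlonglongrightarrow> cmod (deriv \<Theta> w)"
      by (rule tendsto_norm)
    then show ?thesis
    proof (rule LIMSEQ_le_const2, intro exI allI impI)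
      fix n :: nat
      have "cmod (\<Theta> (w + of_real (1 / real (Suc n))) - \<Theta> w) \<le> M * (1 / real (Suc n))"
        using False w by (intro lipU) auto
      moreover have "cmod (complex_of_real (1 / real (Suc n))) = 1 / real (Suc n)"
        by (simp only: norm_of_real) simp
      ultimately show "cmod ((\<Theta> (w + of_real (1 / real (Suc n))) - \<Theta> w) / of_real (1 / real (Suc n))) \<le> M"
        unfolding norm_divide by (metis of_nat_0_less_iff pos_divide_le_eq zero_less_Suc zero_less_divide_1_iff)
    qed
  qed
  have "cmod (\<Theta> (of_real (Re z)) - \<Theta> z) \<le> M * cmod (of_real (Re z) - z)"
  proof (rule field_differentiable_bound[where f = \<Theta> and f' = "deriv \<Theta>" and S = "{w. 0 \<le> Im w \<and> Im w \<le> 1}"])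
    have "{w. 0 \<le> Im w \<and> Im w \<le> 1} = {w. 0 \<le> Im w} \<inter> {w. Im w \<le> 1}" by auto
    then show "convex {w. 0 \<le> Im w \<and> Im w \<le> 1}"
      using convex_halfspace_Im_ge[of 0] convex_halfspace_Im_le[of 1] by (auto intro: convex_Int)
  qed (use z in \<open>auto intro!: der derU\<close>)
  also have "cmod (of_real (Re z) - z) = Im z"
    using z by (simp add: cmod_def)
  finally have "cmod (\<Theta> (of_real (Re z))) - cmod (\<Theta> z) \<le> M * Im z"
    using norm_triangle_ineq2 order_trans by blast
  moreover have "cmod (\<Theta> (of_real (Re z))) = 1"
    using E(2) by (simp add: \<Theta>_def norm_divide)
  ultimately show ?thesis by (simp add: \<Theta>_def)
qed

section \<open>Point evaluation\<close>

lemma hardy_upperD: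
  assumes "g \<in> hardy_upper p"
  obtains M where "M \<ge> 0" "\<And>y. y > 0 \<Longrightarrow> (\<integral>\<^sup>+x. ennreal (cmod (g (Complex x y)) powr p) \<partial>lborel) \<le> ennreal M"
proof
  define S where "S = (SUP y\<in>{0<..}. \<integral>\<^sup>+x. ennreal (cmod (g (Complex x y)) powr p) \<partial>lborel)"
  have "S < \<infinity>" using assms by (simp add: hardy_upper_def S_def)
  then have "ennreal (enn2real S) = S" by (simp add: less_top)
  then show "(\<integral>\<^sup>+x. ennreal (cmod (g (Complex x y)) powr p) \<partial>lborel) \<le> ennreal (enn2real S)" if "y > 0" for y
    using that by (auto simp: S_def intro!: SUP_upper)
qed simp

lemma hermite_biehler_holomorphic: "hermite_biehler E \<Longrightarrow> E holomorphic_on S"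
  by (auto simp: hermite_biehler_def intro: holomorphic_on_subset)

lemma HpE_holomorphic: "f \<in> HpE p E \<Longrightarrow> f holomorphic_on S"
  by (auto simp: HpE_def intro: holomorphic_on_subset)

lemma sharp_HpE: "f \<in> HpE p E \<Longrightarrow> sharp f \<in> HpE p E"
  by (auto simp: HpE_def sharp_holomorphic)

text \<open>\<open>hardy_upper\<close> speaks of positive heights only. Without zeros of
  \<open>E\<close> in the closed half-plane the quotient is continuous up to the real line, and
  Fatou's lemma adds height 0.\<close>

lemma HpE_quotient_bounds:
  assumes E: "hermite_biehler E" "\<forall>x::real. E (of_real x) \<noteq> 0" and f: "f \<in> HpE p E" and p: "p > 0"
  obtains M where "(\<lambda>z. f z / E z) holomorphic_on {w. Im w \<ge> 0}"
    "\<And>y. y \<ge> 0 \<Longrightarrow> (\<integral>\<^sup>+x. ennreal (cmod (f (Complex x y) / E (Complex x y)) powr p) \<partial>lborel) \<le> ennreal M"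
proof -
  have hol: "(\<lambda>z. f z / E z) holomorphic_on {w. Im w \<ge> 0}"
    using hermite_biehler_nonzero[OF E]
    by (intro holomorphic_intros HpE_holomorphic[OF f] hermite_biehler_holomorphic E) auto
  obtain M where M: "\<And>y. y > 0 \<Longrightarrow> (\<integral>\<^sup>+x. ennreal (cmod (f (Complex x y) / E (Complex x y)) powr p) \<partial>lborel) \<le> ennreal M"
    using f hardy_upperD[of "\<lambda>z. f z / E z" p] by (auto simp: HpE_def)
  have "(\<integral>\<^sup>+x. ennreal (cmod (f (of_real x) / E (of_real x)) powr p) \<partial>lborel) \<le> ennreal M"
    by (rule Fatou_real_line[OF holomorphic_on_imp_continuous_on[OF hol] p M])
  then have "(\<integral>\<^sup>+x. ennreal (cmod (f (Complex x y) / E (Complex x y)) powr p) \<partial>lborel) \<le> ennreal M" if "y \<ge> 0" for y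
    using M[of y] that by (cases "y = 0") (simp_all flip: complex_of_real_def)
  then show ?thesis by (rule that[OF hol])
qed

lemma HpE_continuous_real:
  assumes E: "hermite_biehler E" "\<forall>x::real. E (of_real x) \<noteq> 0" and f: "f holomorphic_on UNIV"
  shows "continuous_on S (\<lambda>x. f (of_real x) / E (of_real x))"
proof -
  have *: "continuous_on S (\<lambda>x. g (of_real x))" if "g holomorphic_on UNIV" for g :: "complex \<Rightarrow> complex"
    by (rule continuous_on_compose2[OF holomorphic_on_imp_continuous_on[OF that]]) (auto intro!: continuous_intros)
  show ?thesis
    using E(2) by (intro continuous_on_divide * f hermite_biehler_holomorphic[OF E(1)]) auto
qed

lemma HpE_integrable:
  assumes E: "hermite_biehler E" "\<forall>x::real. E (of_real x) \<noteq> 0" and f: "f \<in> HpE p E" and p: "p > 0"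
  shows "integrable lborel (\<lambda>x. cmod (f (of_real x) / E (of_real x)) powr p)"
proof -
  obtain M where M: "\<And>y. y \<ge> 0 \<Longrightarrow> (\<integral>\<^sup>+x. ennreal (cmod (f (Complex x y) / E (Complex x y)) powr p) \<partial>lborel) \<le> ennreal M"
    using HpE_quotient_bounds[OF E f p] by blast
  have [measurable]: "(\<lambda>x. f (of_real x) / E (of_real x)) \<in> borel_measurable borel"
    by (intro borel_measurable_continuous_onI HpE_continuous_real E HpE_holomorphic[OF f])
  show ?thesis
    using order_le_less_trans[OF M[of 0]] by (intro integrableI_nonneg) (auto simp flip: complex_of_real_def)
qed

lemma normE_nonneg [simp]: "normE p E f \<ge> 0"
  by (simp add: normE_def)

lemma normE_powr:
  assumes "p > 0"
  shows "normE p E f powr p = (\<integral>x. cmod (f (of_real x) / E (of_real x)) powr p \<partial>lborel)"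
proof -
  have "(\<integral>x. cmod (f (of_real x) / E (of_real x)) powr p \<partial>lborel) \<ge> 0"
    by (intro integral_nonneg_AE) auto
  with assms show ?thesis by (simp add: normE_def powr_powr)
qed

text \<open>On the circle \<open>cmod (w - x) = r\<close> the factor \<open>(w - x)\<^sup>2 - r\<^sup>2\<close> has modulus \<open>2 * r * \<bar>Im w\<bar>\<close>,
  which absorbs the singularity of the half-plane bound.\<close>
lemma HpE_point_evaluation:
  assumes E: "hermite_biehler E" "\<forall>x::real. E (of_real x) \<noteq> 0" and ph: "phase_function E \<phi>"
    and M: "AE x in lborel. \<bar>deriv \<phi> x\<bar> \<le> M" "M \<ge> 1" and p: "p \<ge> 1" and f: "f \<in> HpE p E"
  shows "cmod (f (of_real x) / E (of_real x)) \<le> 16 * M * normE p E f"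
proof -
  \<comment> \<open>Half-width of the strip in which \<open>phase_quotient_lower_bound\<close> gives
    at least \<open>1 - M * Im w \<ge> 1 / 2\<close>.\<close>
  define r where "r = 1 / (2 * M)"
  have r: "r > 0" "r \<le> 1 / 2" using M(2) by (auto simp: r_def field_simps)
  have low: "cmod (E (cnj w)) \<ge> cmod (E w) / 2" and nz: "E (cnj w) \<noteq> 0" if "0 \<le> Im w" "Im w \<le> r" for w
  proof -
    have "cmod (sharp E w / E w) \<ge> 1 - M * Im w"
      using that r M(2) by (intro phase_quotient_lower_bound[OF E ph M(1)]) auto
    moreover have "M * Im w \<le> M * r" using that M(2) by (intro mult_left_mono) auto
    moreover have "M * r = 1 / 2" using M(2) by (simp add: r_def)
    ultimately have "cmod (sharp E w / E w) \<ge> 1 / 2" by linarith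
    moreover have "E w \<noteq> 0" using hermite_biehler_nonzero[OF E that(1)] .
    ultimately show "cmod (E (cnj w)) \<ge> cmod (E w) / 2"
      by (simp add: sharp_def norm_divide field_simps)
    with \<open>E w \<noteq> 0\<close> show "E (cnj w) \<noteq> 0" by auto
  qed
  have nz': "E w \<noteq> 0" if "\<bar>Im w\<bar> \<le> r" for w
    using nz[of "cnj w"] hermite_biehler_nonzero[OF E, of w] that by (cases "Im w \<ge> 0") auto
  have upper: "cmod (g w / E w) \<le> 2 * s / Im w"
    if g: "g \<in> HpE p E" and s: "normE p E g \<le> s" "s > 0" and w: "0 < Im w" "Im w \<le> 1" for g s w
  proof -
    obtain B where B: "(\<lambda>z. g z / E z) holomorphic_on {w. Im w \<ge> 0}"
      "\<And>y. y \<ge> 0 \<Longrightarrow> (\<integral>\<^sup>+x. ennreal (cmod (g (Complex x y) / E (Complex x y)) powr p) \<partial>lborel) \<le> ennreal B"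
      using HpE_quotient_bounds[OF E g] p by auto
    have "(\<integral>\<^sup>+x. ennreal (cmod (g (of_real x) / E (of_real x)) powr p) \<partial>lborel) = ennreal (normE p E g powr p)"
      using HpE_integrable[OF E g] p by (subst nn_integral_eq_integral) (auto simp: normE_powr)
    also have "\<dots> \<le> ennreal (s powr p)"
      using s p by (intro ennreal_leI powr_mono2) auto
    finally show ?thesis
      using half_plane_bound[OF B(1) p s(2) B(2) _ w] by simp
  qed
  \<comment> \<open>\<open>half_plane_bound\<close> asks for a positive \<open>s\<close>; a strict
    upper bound of the norm is positive even if the norm is 0, and \<open>dense_ge\<close> later
    lets \<open>s\<close> tend to the norm.\<close>
  have main: "cmod (f (of_real x) / E (of_real x)) \<le> 16 * M * s" if s: "normE p E f < s" for s
  proof -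
    have s0: "s > 0" using s normE_nonneg[of p E f] by linarith
    have norm_sharp: "normE p E (sharp f) = normE p E f"
      by (simp add: normE_def norm_divide)
    define G where "G = (\<lambda>w. f w / E w * ((w - of_real x)\<^sup>2 - (of_real r)\<^sup>2))"
    have strip: "\<bar>Im w\<bar> \<le> r" if "w \<in> cball (of_real x) r" for w
      using that abs_Im_le_cmod[of "of_real x - w"] by (simp add: dist_norm)
    have hol: "G holomorphic_on cball (of_real x) r"
      unfolding G_def using nz' strip
      by (intro holomorphic_intros HpE_holomorphic[OF f] hermite_biehler_holomorphic E) auto
    \<comment> \<open>On the circle \<open>|f / E| * |Im w|\<close> is at most \<open>4 * s\<close>,
      and the remaining factor \<open>2 * r\<close> gives \<open>8 * s * r\<close>. At the centre
      the quadratic factor has modulus \<open>r^2\<close>, so that \<open>|f / E|\<close> is at most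
      \<open>8 * s / r = 16 * M * s\<close> there.\<close>
    have "cmod (G (of_real x)) \<le> 8 * s * r"
    proof (rule maximum_modulus_frontier[where f = G and S = "cball (of_real x) r"])
      show "G holomorphic_on interior (cball (of_real x) r)"
        using hol by (rule holomorphic_on_subset) (rule interior_subset)
      show "continuous_on (closure (cball (of_real x) r)) G"
        using hol by (auto intro: holomorphic_on_imp_continuous_on)
    next
      fix w assume "w \<in> frontier (cball (complex_of_real x) r)"
      then have w: "cmod (w - of_real x) = r"
        using r by (simp add: dist_norm norm_minus_commute)
      define u where "u = w - of_real x"
      have "(of_real r)\<^sup>2 = u * cnj u"
        using complex_norm_square[of u] w unfolding u_def by simp
      then have "(w - of_real x)\<^sup>2 - (of_real r)\<^sup>2 = u * (u - cnj u)"
        by (simp add: u_def power2_eq_square algebra_simps)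
      moreover have "cmod (u - cnj u) = 2 * \<bar>Im w\<bar>"
        by (simp add: u_def complex_diff_cnj norm_mult)
      ultimately have eq: "cmod ((w - of_real x)\<^sup>2 - (of_real r)\<^sup>2) = 2 * r * \<bar>Im w\<bar>"
        using w by (simp add: norm_mult u_def)
      have wr: "\<bar>Im w\<bar> \<le> r"
        using w by (intro strip) (simp add: dist_norm norm_minus_commute)
      have "cmod (f w / E w) * \<bar>Im w\<bar> \<le> 4 * s"
      proof (cases "Im w" "0::real" rule: linorder_cases)
        case greater
        then show ?thesis
          using upper[OF f less_imp_le[OF s] s0 greater] wr r s0 by (simp add: field_simps)
      next
        case less
        \<comment> \<open>Below the real line \<open>|f w|\<close> equals
          \<open>|sharp f (cnj w)|\<close>, to which \<open>upper\<close> applies;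
          \<open>low\<close> exchanges \<open>E (cnj w)\<close> for \<open>E w\<close> at the cost
          of a factor 2.\<close>
        have "cmod (sharp f (cnj w) / E (cnj w)) \<le> 2 * s / Im (cnj w)"
          using less wr r s norm_sharp s0 by (intro upper sharp_HpE[OF f]) auto
        moreover have "cmod (f w / E w) \<le> 2 * cmod (sharp f (cnj w) / E (cnj w))"
        proof -
          have "E (cnj w) \<noteq> 0" "E w \<noteq> 0" using less wr by (auto intro!: nz')
          moreover have "cmod (E (cnj w)) \<le> 2 * cmod (E w)" using low[of "cnj w"] less wr by simp
          ultimately show ?thesis
            using mult_left_mono[of "cmod (E (cnj w))" "2 * cmod (E w)" "cmod (f w)"]
            by (simp add: sharp_def norm_divide field_simps)
        qed
        ultimately have "cmod (f w / E w) \<le> 2 * (2 * s / (- Im w))" by simp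
        then show ?thesis using less by (simp add: field_simps)
      qed (use s0 in auto)
      then have "cmod (f w / E w) * \<bar>Im w\<bar> * (2 * r) \<le> 4 * s * (2 * r)"
        using r by (intro mult_right_mono) auto
      then show "cmod (G w) \<le> 8 * s * r"
        unfolding G_def norm_mult eq by (simp add: algebra_simps)
    qed (use r in auto)
    moreover have "cmod (G (of_real x)) = cmod (f (of_real x) / E (of_real x)) * r * r"
      using r unfolding G_def norm_mult by (simp add: norm_mult power2_eq_square)
    ultimately have "cmod (f (of_real x) / E (of_real x)) * r * r \<le> 8 * s * r"
      by simp
    then have "cmod (f (of_real x) / E (of_real x)) * r \<le> 8 * s" using r by simp
    then show ?thesis using M(2) by (simp add: r_def field_simps)
  qed
  have "cmod (f (of_real x) / E (of_real x)) / (16 * M) \<le> normE p E f"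
  proof (rule dense_ge)
    fix s assume "normE p E f < s"
    from main[OF this] show "cmod (f (of_real x) / E (of_real x)) / (16 * M) \<le> s"
      using M(2) by (simp add: field_simps)
  qed
  then show ?thesis using M(2) by (simp add: field_simps)
qed

text \<open>Membership test for products of \<open>f\<close> with a rational function whose poles
  are cancelled by zeros of \<open>f\<close>. Outside the disc domination suffices; the part of the
  disc in the closed half-plane is compact, so \<open>|g / E| \<le> B\<close> there, and a
  horizontal line meets it in length at most \<open>2 * \<rho>\<close>.\<close>

lemma hardy_upper_dominated:
  fixes f g :: "complex \<Rightarrow> complex"
  assumes E: "hermite_biehler E" "\<forall>x::real. E (of_real x) \<noteq> 0" and p: "p > 0"
    and f: "f holomorphic_on UNIV" "(\<lambda>z. f z / E z) \<in> hardy_upper p" and g: "g holomorphic_on UNIV"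
    and dom: "C \<ge> 0" "\<rho> \<ge> 0" "\<And>z. cmod (z - a) \<ge> \<rho> \<Longrightarrow> cmod (g z) \<le> C * cmod (f z)"
  shows "(\<lambda>z. g z / E z) \<in> hardy_upper p"
proof -
  define K where "K = cball a \<rho> \<inter> {w. Im w \<ge> 0}"
  have nz: "E w \<noteq> 0" if "Im w \<ge> 0" for w
    by (rule hermite_biehler_nonzero[OF E that])
  have hol: "(\<lambda>z. h z / E z) holomorphic_on {w. Im w \<ge> 0}" if "h holomorphic_on UNIV" for h
    using nz by (intro holomorphic_intros holomorphic_on_subset[OF that] hermite_biehler_holomorphic E) auto
  have "compact K"
    unfolding K_def by (intro compact_Int_closed closed_halfspace_Im_ge) auto
  moreover have "continuous_on K (\<lambda>z. g z / E z)"
    using hol[OF g] by (intro holomorphic_on_imp_continuous_on) (auto intro: holomorphic_on_subset simp: K_def)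
  ultimately have "bounded ((\<lambda>z. g z / E z) ` K)"
    by (intro compact_imp_bounded compact_continuous_image)
  then obtain B where B: "B > 0" "\<And>z. z \<in> K \<Longrightarrow> cmod (g z / E z) \<le> B"
    by (auto simp: bounded_pos)
  obtain M where M: "M \<ge> 0" "\<And>y. y > 0 \<Longrightarrow> (\<integral>\<^sup>+x. ennreal (cmod (f (Complex x y) / E (Complex x y)) powr p) \<partial>lborel) \<le> ennreal M"
    using hardy_upperD[OF f(2)] by blast
  have bound: "(\<integral>\<^sup>+x. ennreal (cmod (g (Complex x y) / E (Complex x y)) powr p) \<partial>lborel)
      \<le> ennreal (C powr p) * ennreal M + ennreal (B powr p) * ennreal (2 * \<rho>)" if y: "y > 0" for y
  proof -
    have [measurable]: "(\<lambda>x. cmod (f (Complex x y) / E (Complex x y))) \<in> borel_measurable borel"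
      by (intro borel_measurable_continuous_onI continuous_on_norm
          continuous_on_compose2[OF holomorphic_on_imp_continuous_on[OF hol[OF f(1)]]])
        (use y in \<open>auto simp: Complex_eq intro!: continuous_intros\<close>)
    have "(\<integral>\<^sup>+x. ennreal (cmod (g (Complex x y) / E (Complex x y)) powr p) \<partial>lborel)
      \<le> (\<integral>\<^sup>+x. ennreal (C powr p) * ennreal (cmod (f (Complex x y) / E (Complex x y)) powr p)
          + ennreal (B powr p) * indicator {Re a - \<rho>..Re a + \<rho>} x \<partial>lborel)"
    proof (rule nn_integral_mono)
      fix x
      show "ennreal (cmod (g (Complex x y) / E (Complex x y)) powr p)
        \<le> ennreal (C powr p) * ennreal (cmod (f (Complex x y) / E (Complex x y)) powr p)
          + ennreal (B powr p) * indicator {Re a - \<rho>..Re a + \<rho>} x"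
      proof (cases "cmod (Complex x y - a) \<ge> \<rho>")
        case True
        have "cmod (g (Complex x y) / E (Complex x y)) \<le> C * cmod (f (Complex x y) / E (Complex x y))"
          using dom(3)[OF True] by (simp add: norm_divide divide_right_mono)
        then have "cmod (g (Complex x y) / E (Complex x y)) powr p \<le> (C * cmod (f (Complex x y) / E (Complex x y))) powr p"
          using p by (intro powr_mono2) auto
        then have "ennreal (cmod (g (Complex x y) / E (Complex x y)) powr p) \<le> ennreal (C powr p) * ennreal (cmod (f (Complex x y) / E (Complex x y)) powr p)"
          using dom(1) by (simp add: powr_mult ennreal_mult[symmetric] ennreal_leI)
        then show ?thesis by (simp add: add_increasing2)
      next
        case False
        then have "\<bar>x - Re a\<bar> \<le> \<rho>"
          using abs_Re_le_cmod[of "Complex x y - a"] by simp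
        then have x: "x \<in> {Re a - \<rho>..Re a + \<rho>}" by auto
        have "cmod (g (Complex x y) / E (Complex x y)) \<le> B"
          using False y by (intro B) (auto simp: K_def dist_norm norm_minus_commute)
        then have "cmod (g (Complex x y) / E (Complex x y)) powr p \<le> B powr p"
          using p by (intro powr_mono2) auto
        then show ?thesis using x by (simp add: add_increasing ennreal_leI)
      qed
    qed
    also have "\<dots> = ennreal (C powr p) * (\<integral>\<^sup>+x. ennreal (cmod (f (Complex x y) / E (Complex x y)) powr p) \<partial>lborel)
        + ennreal (B powr p) * ennreal (2 * \<rho>)"
      using dom(2) by (subst nn_integral_add) (auto simp: nn_integral_cmult nn_integral_cmult_indicator)
    also have "\<dots> \<le> ennreal (C powr p) * ennreal M + ennreal (B powr p) * ennreal (2 * \<rho>)"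
      using M(2)[OF y] by (intro add_right_mono mult_left_mono) auto
    finally show ?thesis .
  qed
  have "(SUP y\<in>{0<..}. \<integral>\<^sup>+x. ennreal (cmod (g (Complex x y) / E (Complex x y)) powr p) \<partial>lborel)
      \<le> ennreal (C powr p) * ennreal M + ennreal (B powr p) * ennreal (2 * \<rho>)"
    using bound by (intro SUP_least) auto
  also have "\<dots> < \<infinity>"
    by (auto simp: ennreal_mult_less_top)
  finally show ?thesis
    unfolding hardy_upper_def using holomorphic_on_subset[OF hol[OF g]] by (auto simp: subset_iff)
qed

text \<open>The condition is symmetric under conjugation: \<open>sharp g\<close> is dominated by
  \<open>sharp f\<close> outside the disc about \<open>cnj a\<close>.\<close>

lemma HpE_dominated:
  fixes f g :: "complex \<Rightarrow> complex"
  assumes E: "hermite_biehler E" "\<forall>x::real. E (of_real x) \<noteq> 0" and p: "p > 0"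
    and f: "f \<in> HpE p E" and g: "g holomorphic_on UNIV"
    and dom: "C \<ge> 0" "\<rho> \<ge> 0" "\<And>z. cmod (z - a) \<ge> \<rho> \<Longrightarrow> cmod (g z) \<le> C * cmod (f z)"
  shows "g \<in> HpE p E"
proof -
  have fh: "f holomorphic_on UNIV" by (rule HpE_holomorphic[OF f])
  have dom': "cmod (sharp g z) \<le> C * cmod (sharp f z)" if "cmod (z - cnj a) \<ge> \<rho>" for z
  proof -
    have "cmod (cnj z - a) = cmod (z - cnj a)"
      by (metis complex_cnj_cnj complex_cnj_diff complex_mod_cnj)
    then show ?thesis using dom(3)[of "cnj z"] that by (simp add: sharp_def)
  qed
  show ?thesis
    using hardy_upper_dominated[OF E p fh _ g dom]
      hardy_upper_dominated[OF E p sharp_holomorphic[OF fh] _ sharp_holomorphic[OF g] dom(1,2) dom'] f g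
    by (simp add: HpE_def)
qed

section \<open>Zeros of entire functions\<close>

lemma entire_divide_zero:
  fixes f :: "complex \<Rightarrow> complex"
  assumes "f holomorphic_on UNIV" "f a = 0"
  obtains g where "g holomorphic_on UNIV" "\<And>z. f z = (z - a) * g z"
proof
  show "(\<lambda>z. if z = a then deriv f a else (f z - f a) / (z - a)) holomorphic_on UNIV"
    using assms by (intro pole_lemma_open) auto
qed (use assms in auto)

lemma entire_nonzero_AE:
  fixes f :: "complex \<Rightarrow> complex"
  assumes f: "f holomorphic_on UNIV" "f \<noteq> (\<lambda>_. 0)"
  shows "countable {z. f z = 0}" "AE x in lborel. f (of_real x) \<noteq> 0"
proof -
  show c: "countable {z. f z = 0}"
  proof (cases "f constant_on UNIV")
    case True
    then obtain k where "\<And>z. f z = k" by (auto simp: constant_on_def)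
    with f(2) have "{z. f z = 0} = {}" by auto
    then show ?thesis by simp
  next
    case False
    then show ?thesis
      using holomorphic_countable_zeros[of f UNIV] f by auto
  qed
  have "complex_of_real ` {x. f (of_real x) = 0} \<subseteq> {z. f z = 0}" by auto
  then have "countable (complex_of_real ` {x. f (of_real x) = 0})"
    using c countable_subset by blast
  then have "countable {x. f (of_real x) = 0}"
    by (rule countable_image_inj_on) (simp add: inj_on_def)
  then show "AE x in lborel. f (of_real x) \<noteq> 0"
    by (intro AE_I'[OF countable_imp_null_set_lborel]) auto
qed

section \<open>The optimal constant of point evaluation\<close>

locale bounded_phase =
  fixes E :: "complex \<Rightarrow> complex" and \<phi> :: "real \<Rightarrow> real" and M p :: real
  assumes hb: "hermite_biehler E" and nonzero: "\<forall>x::real. E (of_real x) \<noteq> 0"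
    and phase: "phase_function E \<phi>" and phase_le: "AE x in lborel. \<bar>deriv \<phi> x\<bar> \<le> M" and M: "M \<ge> 1"
    and p: "p \<ge> 1"
begin

lemmas E = hb nonzero

lemma p_pos: "p > 0"
  using p by simp

lemmas point_evaluation = HpE_point_evaluation[OF hb nonzero phase phase_le M p]
lemmas HpE_dom = HpE_dominated[OF hb nonzero p_pos]

text \<open>Shows that the infimum in \<open>point_const\<close> is itself an admissible constant.
  \<open>point_evaluation\<close> makes the set of constants nonempty and settles functions of norm
  0.\<close>

lemma point_const_bound:
  assumes "g \<in> HpE p E"
  shows "cmod (g (of_real \<xi>) / E (of_real \<xi>)) \<le> point_const p E \<xi> * normE p E g"
proof (cases "normE p E g = 0")
  case True
  then show ?thesis using point_evaluation[OF assms, of \<xi>] by simp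
next
  case False
  then have pos: "normE p E g > 0" using normE_nonneg[of p E g] by linarith
  have "cmod (g (of_real \<xi>) / E (of_real \<xi>)) / normE p E g \<le> point_const p E \<xi>"
    unfolding point_const_def
  proof (rule cInf_greatest)
    show "{C. \<forall>f\<in>HpE p E. cmod (f (of_real \<xi>) / E (of_real \<xi>)) \<le> C * normE p E f} \<noteq> {}"
      using point_evaluation by blast
  next
    fix C assume "C \<in> {C. \<forall>f\<in>HpE p E. cmod (f (of_real \<xi>) / E (of_real \<xi>)) \<le> C * normE p E f}"
    then show "cmod (g (of_real \<xi>) / E (of_real \<xi>)) / normE p E g \<le> C"
      using assms pos by (simp add: pos_divide_le_eq)
  qed
  then show ?thesis using pos by (simp add: pos_divide_le_eq)
qed

text \<open>Otherwise every member of the space vanishes at \<open>\<xi>\<close>. Since division by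
  \<open>z - \<xi>\<close> then stays in the space, \<open>f\<close> is divisible by all powers of
  \<open>z - \<xi>\<close> and hence zero.\<close>

lemma point_const_pos:
  assumes f: "f \<in> HpE p E" "f \<noteq> (\<lambda>_. 0)"
  shows "point_const p E \<xi> > 0"
proof (rule ccontr)
  assume "\<not> point_const p E \<xi> > 0"
  then have vanish: "g (of_real \<xi>) = 0" if "g \<in> HpE p E" for g
  proof -
    have "point_const p E \<xi> * normE p E g \<le> 0"
      using \<open>\<not> point_const p E \<xi> > 0\<close> by (intro mult_nonpos_nonneg) auto
    then have "cmod (g (of_real \<xi>) / E (of_real \<xi>)) \<le> 0"
      using point_const_bound[OF that, of \<xi>] by linarith
    then show ?thesis using nonzero by simp
  qed
  have factor: "\<exists>g\<in>HpE p E. \<forall>z. f z = (z - of_real \<xi>) ^ n * g z" for n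
  proof (induction n)
    case 0
    then show ?case using f(1) by auto
  next
    case (Suc n)
    then obtain g where g: "g \<in> HpE p E" "\<And>z. f z = (z - of_real \<xi>) ^ n * g z" by blast
    obtain h where h: "h holomorphic_on UNIV" "\<And>z. g z = (z - of_real \<xi>) * h z"
      using entire_divide_zero[OF HpE_holomorphic[OF g(1)] vanish[OF g(1)]] by blast
    have "h \<in> HpE p E"
    proof (rule HpE_dom[OF g(1) h(1), of 1 1 "of_real \<xi>"])
      fix z assume "1 \<le> cmod (z - of_real \<xi>)"
      from mult_right_mono[OF this norm_ge_zero[of "h z"]] show "cmod (h z) \<le> 1 * cmod (g z)"
        by (simp add: h(2) norm_mult)
    qed auto
    then show ?case using g(2) h(2) by (intro bexI[of _ h]) (auto simp: mult_ac)
  qed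
  have fh: "f holomorphic_on S" for S by (rule HpE_holomorphic[OF f(1)])
  have "compact (f ` sphere (of_real \<xi>) 1)"
    by (intro compact_continuous_image holomorphic_on_imp_continuous_on fh) auto
  then have "\<exists>B. \<forall>y\<in>f ` sphere (of_real \<xi>) 1. cmod y \<le> B"
    by (subst bounded_iff[symmetric]) (rule compact_imp_bounded)
  then obtain B where "\<forall>y\<in>f ` sphere (of_real \<xi>) 1. cmod y \<le> B" ..
  then have B: "\<And>z. cmod (z - of_real \<xi>) = 1 \<Longrightarrow> cmod (f z) \<le> B"
    by (simp add: dist_norm norm_minus_commute)
  have zero: "f z = 0" if z: "z \<in> ball (of_real \<xi>) 1" for z
  proof -
    have "cmod (f z) \<le> cmod (z - of_real \<xi>) ^ n * B" for n
    proof -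
      obtain g where g: "g \<in> HpE p E" "\<And>z. f z = (z - of_real \<xi>) ^ n * g z"
        using factor by blast
      \<comment> \<open>On the unit circle about \<open>\<xi>\<close> the power has modulus 1, so
        \<open>|g| = |f| \<le> B\<close> there with the same \<open>B\<close> for every
        \<open>n\<close>.\<close>
      have "cmod (g z) \<le> B"
      proof (rule maximum_modulus_frontier[where f = g and S = "cball (of_real \<xi>) 1"])
        fix w assume "w \<in> frontier (cball (complex_of_real \<xi>) 1)"
        then have "cmod (w - of_real \<xi>) = 1" by (simp add: dist_norm norm_minus_commute)
        then show "cmod (g w) \<le> B" using B[of w] g(2)[of w] by (simp add: norm_mult norm_power)
      qed (use z in \<open>auto intro!: HpE_holomorphic[OF g(1)] holomorphic_on_imp_continuous_on\<close>)
      then show ?thesis by (simp add: g(2)[of z] norm_mult norm_power mult_left_mono)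
    qed
    moreover have "(\<lambda>n. cmod (z - of_real \<xi>) ^ n * B) \<longlonglongrightarrow> 0 * B"
      using z by (intro tendsto_mult LIMSEQ_power_zero tendsto_const) (simp add: dist_norm norm_minus_commute)
    ultimately have "cmod (f z) \<le> 0"
      using LIMSEQ_le_const[of "\<lambda>n. cmod (z - of_real \<xi>) ^ n * B" "0 * B" "cmod (f z)"] by auto
    then show ?thesis by simp
  qed
  have "f w = 0" for w
  proof (rule analytic_continuation_open[of "ball (of_real \<xi>) 1" UNIV f "\<lambda>_. 0"])
  qed (use zero fh in auto)
  then show False using f(2) by auto
qed

end

section \<open>The variational equation\<close>

text \<open>The mean value theorem, where \<open>p \<ge> 1\<close> lets the derivative at the
  intermediate point be replaced by that at \<open>x\<close>. The case \<open>y = 0\<close> is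
  treated apart because the derivative rule for \<open>powr\<close> wants a positive base.\<close>

lemma powr_diff_le:
  fixes x y p :: real
  assumes p: "p \<ge> 1" and xy: "0 \<le> y" "y \<le> x"
  shows "x powr p - y powr p \<le> p * x powr (p - 1) * (x - y)"
proof (cases "y = 0 \<or> y = x")
  case True
  have "x powr p \<le> p * (x powr (p - 1) * x)"
  proof -
    have "x powr p = x powr (p - 1) * x"
      using xy by (cases "x = 0") (auto simp: powr_mult_base mult.commute)
    moreover have "x powr (p - 1) * x \<ge> 0" using xy by simp
    ultimately show ?thesis using p mult_right_mono[of 1 p "x powr (p - 1) * x"] by simp
  qed
  with True show ?thesis by (auto simp: mult.assoc)
next
  case False
  with xy have *: "0 < y" "y < x" by auto
  have "\<exists>z>y. z < x \<and> x powr p - y powr p = (x - y) * (p * z powr (p - 1))"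
    using * by (intro MVT2) (auto intro!: derivative_eq_intros)
  then obtain z where z: "y < z" "z < x" "x powr p - y powr p = (x - y) * (p * z powr (p - 1))"
    by blast
  have "z powr (p - 1) \<le> x powr (p - 1)"
    using z * p by (intro powr_mono2) auto
  then have "(x - y) * (p * z powr (p - 1)) \<le> (x - y) * (p * x powr (p - 1))"
    using * p by (intro mult_left_mono) auto
  then show ?thesis using z by (simp add: mult_ac)
qed

text \<open>Supplies the integrable majorant for dominated convergence of the difference quotients.
  With \<open>m\<close> the larger modulus, all moduli involved are at most \<open>2 * m\<close>,
  and \<open>m powr p\<close> is at most the sum of the two powers.\<close>

lemma norm_powr_diff_le:
  fixes a b :: complex
  assumes p: "p \<ge> 1" and t: "\<bar>t\<bar> \<le> 1"
  shows "\<bar>cmod (a + of_real t * b) powr p - cmod a powr p\<bar> \<le> \<bar>t\<bar> * (p * 2 powr p * (cmod a powr p + cmod b powr p))"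
proof -
  define m where "m = max (cmod a) (cmod b)"
  define x where "x = cmod (a + of_real t * b)"
  have tb: "cmod (of_real t * b) \<le> 1 * cmod b"
    unfolding norm_mult using t by (intro mult_right_mono) auto
  have x: "0 \<le> x" "x \<le> 2 * m" "\<bar>x - cmod a\<bar> \<le> \<bar>t\<bar> * cmod b"
  proof -
    show "x \<le> 2 * m"
      using norm_triangle_ineq[of a "of_real t * b"] tb by (simp add: x_def m_def)
    show "\<bar>x - cmod a\<bar> \<le> \<bar>t\<bar> * cmod b"
      using norm_triangle_ineq3[of "a + of_real t * b" a] by (simp add: x_def norm_mult)
  qed (simp add: x_def)
  have "\<bar>u powr p - v powr p\<bar> \<le> p * (2 * m) powr (p - 1) * \<bar>u - v\<bar>"
    if "0 \<le> u" "0 \<le> v" "u \<le> 2 * m" "v \<le> 2 * m" for u v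
  proof -
    have *: "\<bar>u powr p - v powr p\<bar> \<le> p * (2 * m) powr (p - 1) * \<bar>u - v\<bar>"
      if "0 \<le> v" "v \<le> u" "u \<le> 2 * m" for u v
    proof -
      have "u powr p - v powr p \<le> p * u powr (p - 1) * (u - v)"
        using that by (intro powr_diff_le p) auto
      also have "\<dots> \<le> p * (2 * m) powr (p - 1) * (u - v)"
        using that p by (intro mult_right_mono mult_left_mono powr_mono2) auto
      finally show ?thesis using that p by (simp add: powr_mono2)
    qed
    show ?thesis
      using *[of v u] *[of u v] that by (cases "v \<le> u") (auto simp: abs_minus_commute)
  qed
  from this[of x "cmod a"] have "\<bar>x powr p - cmod a powr p\<bar> \<le> p * (2 * m) powr (p - 1) * \<bar>x - cmod a\<bar>"
    using x by (auto simp: m_def)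
  also have "\<dots> \<le> p * (2 * m) powr (p - 1) * (\<bar>t\<bar> * (2 * m))"
  proof (intro mult_left_mono order_trans[OF x(3)])
    have "cmod b \<le> m" "0 \<le> m" by (auto simp: m_def le_max_iff_disj)
    then show "cmod b \<le> 2 * m" by linarith
  qed (use p in auto)
  also have "\<dots> = \<bar>t\<bar> * (p * (2 * m) powr p)"
  proof -
    have "(2 * m) powr p = (2 * m) powr (p - 1) * (2 * m)"
      using powr_add[of "2 * m" "p - 1" 1] by (simp add: m_def le_max_iff_disj)
    then show ?thesis by (simp only: mult_ac)
  qed
  also have "(2 * m) powr p = 2 powr p * m powr p"
    by (simp add: powr_mult m_def)
  also have "\<bar>t\<bar> * (p * (2 powr p * m powr p)) \<le> \<bar>t\<bar> * (p * (2 powr p * (cmod a powr p + cmod b powr p)))"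
    using p by (intro mult_left_mono) (auto simp: m_def max_def)
  finally show ?thesis by (simp add: x_def mult_ac)
qed

text \<open>After factoring out \<open>a\<close> there remains \<open>|1 + t * r|\<close>, whose
  square is a quadratic polynomial in \<open>t\<close> with value 1 at 0. Writing the power as
  \<open>powr (p / 2)\<close> of this square makes it differentiable at 0, with derivative
  \<open>p * Re r\<close>.\<close>

lemma norm_powr_quotient_tendsto:
  fixes a b :: complex
  assumes "a \<noteq> 0"
  shows "(\<lambda>n. (cmod (a + of_real (1 / real (Suc n)) * b) powr p - cmod a powr p) / (1 / real (Suc n)))
    \<longlonglongrightarrow> cmod a powr p * (p * Re (b / a))"
proof -
  define r where "r = b / a"
  define h where "h = (\<lambda>t::real. (1 + 2 * t * Re r + t\<^sup>2 * (cmod r)\<^sup>2) powr (p / 2))"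
  have "(h has_real_derivative p * Re r) (at 0)"
    unfolding h_def by (auto intro!: derivative_eq_intros)
  then have "((\<lambda>t. (h t - h 0) / t) \<longlongrightarrow> p * Re r) (at 0)"
    by (simp add: DERIV_def)
  moreover have "filterlim (\<lambda>n. 1 / real (Suc n)) (at 0) sequentially"
    unfolding filterlim_at using LIMSEQ_Suc[OF lim_1_over_n[where 'a=real]] by auto
  ultimately have "(\<lambda>n. (h (1 / real (Suc n)) - h 0) / (1 / real (Suc n))) \<longlonglongrightarrow> p * Re r"
    by (rule filterlim_compose)
  then have "(\<lambda>n. cmod a powr p * ((h (1 / real (Suc n)) - h 0) / (1 / real (Suc n)))) \<longlonglongrightarrow> cmod a powr p * (p * Re r)"
    by (rule tendsto_mult_left)
  moreover have "cmod (a + of_real t * b) powr p = cmod a powr p * h t" for t :: real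
  proof -
    have "a + of_real t * b = a * (1 + of_real t * r)"
      using assms by (simp add: r_def field_simps)
    moreover have "(cmod (1 + of_real t * r))\<^sup>2 = 1 + 2 * t * Re r + t\<^sup>2 * (cmod r)\<^sup>2"
      unfolding cmod_power2 by (simp add: power2_eq_square algebra_simps)
    then have "h t = (cmod (1 + of_real t * r))\<^sup>2 powr (p / 2)"
      by (simp add: h_def)
    then have "h t = cmod (1 + of_real t * r) powr p"
      unfolding powr_numeral[OF norm_ge_zero, symmetric] powr_powr by simp
    ultimately show ?thesis by (simp add: norm_mult powr_mult)
  qed
  moreover have "h 0 = 1" by (simp add: h_def)
  ultimately show ?thesis
    by (simp only: r_def right_diff_distrib times_divide_eq_right mult_1_right)
qed

section \<open>First variation at an extremal function\<close>

context bounded_phase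
begin

text \<open>For \<open>t > 0\<close> the function \<open>f + t g\<close> has the same value at
  \<open>\<xi>\<close> as \<open>f\<close>, so by extremality and positivity of the constant its
  norm is not smaller. Difference quotients of the \<open>p\<close>-th powers therefore have
  nonnegative integrals, and dominated convergence lets \<open>t\<close> tend to 0.\<close>

lemma extremal_nonneg:
  assumes f: "f \<in> HpE p E" "f \<noteq> (\<lambda>_. 0)"
    and ext: "cmod (f (of_real \<xi>) / E (of_real \<xi>)) = point_const p E \<xi> * normE p E f"
    and g: "g holomorphic_on UNIV" "g (of_real \<xi>) = 0"
    and dom: "C \<ge> 0" "\<rho> \<ge> 0" "\<And>z. cmod (z - a) \<ge> \<rho> \<Longrightarrow> cmod (g z) \<le> C * cmod (f z)"
  shows "integrable lborel (\<lambda>x. cmod (f (of_real x) / E (of_real x)) powr p * Re (g (of_real x) / f (of_real x)))"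
    and "(\<integral>x. cmod (f (of_real x) / E (of_real x)) powr p * Re (g (of_real x) / f (of_real x)) \<partial>lborel) \<ge> 0"
proof -
  define F G where "F = (\<lambda>x::real. f (of_real x) / E (of_real x))" and "G = (\<lambda>x::real. g (of_real x) / E (of_real x))"
  define t where "t = (\<lambda>n. 1 / real (Suc n))"
  have t: "0 < t n" "t n \<le> 1" for n by (auto simp: t_def field_simps)
  define q where "q = (\<lambda>n x. (cmod (F x + of_real (t n) * G x) powr p - cmod (F x) powr p) / t n)"
  define w where "w = (\<lambda>x. p * 2 powr p * (cmod (F x) powr p + cmod (G x) powr p))"
  have fh: "f holomorphic_on UNIV" by (rule HpE_holomorphic[OF f(1)])
  have gH: "g \<in> HpE p E"
    by (rule HpE_dom[OF f(1) g(1) dom])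
  have sumH: "(\<lambda>z. f z + of_real (t n) * g z) \<in> HpE p E" for n
  proof (rule HpE_dom[OF f(1) _ _ dom(2)])
    show "(\<lambda>z. f z + of_real (t n) * g z) holomorphic_on UNIV"
      using fh g(1) by (intro holomorphic_intros)
    fix z assume z: "\<rho> \<le> cmod (z - a)"
    have "cmod (f z + of_real (t n) * g z) \<le> cmod (f z) + t n * cmod (g z)"
      using norm_triangle_ineq[of "f z" "of_real (t n) * g z"] t[of n] by (simp add: norm_mult)
    also have "\<dots> \<le> cmod (f z) + 1 * (C * cmod (f z))"
      using t[of n] dom(3)[OF z] by (intro add_left_mono mult_mono) auto
    finally show "cmod (f z + of_real (t n) * g z) \<le> (1 + C) * cmod (f z)"
      by (simp add: algebra_simps)
  qed (use dom in auto)
  have meas [measurable]: "F \<in> borel_measurable borel" "G \<in> borel_measurable borel"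
    unfolding F_def G_def by (auto intro!: borel_measurable_continuous_onI HpE_continuous_real[OF E] fh g(1))
  have intF: "integrable lborel (\<lambda>x. cmod (F x) powr p)" and intG: "integrable lborel (\<lambda>x. cmod (G x) powr p)"
    unfolding F_def G_def by (auto intro!: HpE_integrable[OF E _ p_pos] f gH)
  have sum_eq: "(f (of_real x) + of_real (t n) * g (of_real x)) / E (of_real x) = F x + of_real (t n) * G x" for x n
    by (simp add: F_def G_def add_divide_distrib)
  have intS: "integrable lborel (\<lambda>x. cmod (F x + of_real (t n) * G x) powr p)" for n
    using HpE_integrable[OF E sumH p_pos] unfolding sum_eq .
  have q_nonneg: "(\<integral>x. q n x \<partial>lborel) \<ge> 0" for n
  proof -
    have c: "point_const p E \<xi> > 0" by (rule point_const_pos[OF f])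
    have "point_const p E \<xi> * normE p E f \<le> point_const p E \<xi> * normE p E (\<lambda>z. f z + of_real (t n) * g z)"
      using point_const_bound[OF sumH, of \<xi> n] ext g(2) by simp
    then have "normE p E f \<le> normE p E (\<lambda>z. f z + of_real (t n) * g z)"
      using c by simp
    then have "normE p E f powr p \<le> normE p E (\<lambda>z. f z + of_real (t n) * g z) powr p"
      using p by (intro powr_mono2) auto
    then have "(\<integral>x. cmod (F x) powr p \<partial>lborel) \<le> (\<integral>x. cmod (F x + of_real (t n) * G x) powr p \<partial>lborel)"
      unfolding normE_powr[OF p_pos] sum_eq by (simp add: F_def)
    then have "0 \<le> (\<integral>x. cmod (F x + of_real (t n) * G x) powr p - cmod (F x) powr p \<partial>lborel)"
      using intS intF by (subst Bochner_Integration.integral_diff) auto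
    then show ?thesis using t[of n] unfolding q_def by simp
  qed
  define L where "L = (\<lambda>x. p * (cmod (F x) powr p * Re (G x / F x)))"
  have gf: "g (of_real x) / f (of_real x) = G x / F x" for x
    using nonzero by (simp add: F_def G_def)
  have F_eq: "f (of_real x) / E (of_real x) = F x" for x
    by (simp add: F_def)
  have L: "L \<in> borel_measurable lborel" unfolding L_def by measurable
  have lim: "AE x in lborel. (\<lambda>n. q n x) \<longlonglongrightarrow> L x"
  proof (rule AE_mp[OF entire_nonzero_AE(2)[OF fh f(2)]], rule AE_I2, rule impI)
    fix x assume "f (complex_of_real x) \<noteq> 0"
    then have nz: "F x \<noteq> 0"
      using nonzero by (simp add: F_def)
    show "(\<lambda>n. q n x) \<longlonglongrightarrow> L x"
      using norm_powr_quotient_tendsto[OF nz, of "G x" p] unfolding q_def t_def L_def by (simp add: mult_ac)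
  qed
  have bnd: "AE x in lborel. norm (q n x) \<le> w x" for n
  proof (rule AE_I2)
    fix x
    have "\<bar>cmod (F x + of_real (t n) * G x) powr p - cmod (F x) powr p\<bar> \<le> \<bar>t n\<bar> * w x"
      unfolding w_def using t[of n] by (intro norm_powr_diff_le p) auto
    then show "norm (q n x) \<le> w x" using t[of n] by (simp add: q_def field_simps)
  qed
  have w: "integrable lborel w"
    unfolding w_def using intF intG by auto
  have q: "q n \<in> borel_measurable lborel" for n
    unfolding q_def by measurable
  have "integrable lborel L"
    by (rule integrable_dominated_convergence[OF L q w lim bnd])
  then have "integrable lborel (\<lambda>x. 1 / p * L x)"
    by (rule integrable_mult_right)
  then show "integrable lborel (\<lambda>x. cmod (f (of_real x) / E (of_real x)) powr p * Re (g (of_real x) / f (of_real x)))"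
    unfolding gf F_eq L_def using p by simp
  have "(\<lambda>n. \<integral>x. q n x \<partial>lborel) \<longlonglongrightarrow> (\<integral>x. L x \<partial>lborel)"
    by (rule integral_dominated_convergence[OF L q w lim bnd])
  then have "(\<integral>x. L x \<partial>lborel) \<ge> 0"
    by (rule LIMSEQ_le_const) (use q_nonneg in auto)
  then show "(\<integral>x. cmod (f (of_real x) / E (of_real x)) powr p * Re (g (of_real x) / f (of_real x)) \<partial>lborel) \<ge> 0"
    unfolding gf F_eq L_def using p by (simp add: zero_le_mult_iff)
qed

text \<open>Combines the inequality for \<open>g\<close> with that for \<open>- g\<close>.\<close>

lemma extremal_orthogonal:
  assumes f: "f \<in> HpE p E" "f \<noteq> (\<lambda>_. 0)"
    and ext: "cmod (f (of_real \<xi>) / E (of_real \<xi>)) = point_const p E \<xi> * normE p E f"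
    and g: "g holomorphic_on UNIV" "g (of_real \<xi>) = 0"
    and dom: "C \<ge> 0" "\<rho> \<ge> 0" "\<And>z. cmod (z - a) \<ge> \<rho> \<Longrightarrow> cmod (g z) \<le> C * cmod (f z)"
  shows "has_bochner_integral lborel
    (\<lambda>x. cmod (f (of_real x) / E (of_real x)) powr p * Re (g (of_real x) / f (of_real x))) 0"
proof -
  have "(\<lambda>z. - g z) holomorphic_on UNIV" using g(1) by (intro holomorphic_intros)
  from extremal_nonneg(2)[OF f ext this _ dom(1,2), of a] dom(3) g(2)
  have "0 \<le> (\<integral>x. cmod (f (of_real x) / E (of_real x)) powr p * Re (- g (of_real x) / f (of_real x)) \<partial>lborel)"
    by simp
  then show ?thesis
    using extremal_nonneg[OF f ext g dom] by (simp add: has_bochner_integral_iff)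
qed

end

section \<open>Zeros of extremal functions\<close>

lemma not_AE_lborel_False: "\<not> (AE x in (lborel :: real measure). False)"
  by (simp add: eventually_False ae_filter_eq_bot_iff)

text \<open>Moving a zero from \<open>l\<close> to \<open>c\<close> costs a bounded factor away from
  \<open>l\<close>; this provides the domination hypotheses.\<close>

lemma norm_diff_le_mult:
  fixes z l c :: complex
  assumes "cmod (z - l) \<ge> \<rho>" "\<rho> > 0"
  shows "cmod (z - c) \<le> (1 + cmod (l - c) / \<rho>) * cmod (z - l)"
proof -
  have "cmod (l - c) * \<rho> \<le> cmod (l - c) * cmod (z - l)"
    using assms by (intro mult_left_mono) auto
  then have "cmod (l - c) \<le> cmod (l - c) / \<rho> * cmod (z - l)"
    using assms by (simp add: field_simps)
  moreover have "cmod (z - c) \<le> cmod (z - l) + cmod (l - c)"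
    using norm_triangle_ineq[of "z - l" "l - c"] by simp
  ultimately show ?thesis by (simp add: distrib_right)
qed

context bounded_phase
begin

text \<open>The factor \<open>\<alpha>\<close> is chosen so that \<open>Re (\<alpha> * (x - \<xi>) / (x - l)) = (x - \<xi>)\<^sup>2 / (cmod (x - l))\<^sup>2\<close>
  for real \<open>x\<close>.\<close>
lemma extremal_zeros_real:
  assumes f: "f \<in> HpE p E" "f \<noteq> (\<lambda>_. 0)"
    and ext: "cmod (f (of_real \<xi>) / E (of_real \<xi>)) = point_const p E \<xi> * normE p E f"
    and l: "f l = 0"
  shows "Im l = 0"
proof (rule ccontr)
  assume b: "Im l \<noteq> 0"
  define \<alpha> where "\<alpha> = Complex 1 ((\<xi> - Re l) / Im l)"
  have fh: "f holomorphic_on UNIV" by (rule HpE_holomorphic[OF f(1)])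
  obtain h where h: "h holomorphic_on UNIV" "\<And>z. f z = (z - l) * h z"
    using entire_divide_zero[OF fh l] by blast
  \<comment> \<open>The zero of \<open>f\<close> at \<open>l\<close> is moved to
    \<open>\<xi>\<close>, which makes \<open>g\<close> admissible in
    \<open>extremal_orthogonal\<close>.\<close>
  define g where "g = (\<lambda>z. \<alpha> * (z - of_real \<xi>) * h z)"
  define u where "u = (\<lambda>x. cmod (f (complex_of_real x) / E (of_real x)) powr p)"
  have "has_bochner_integral lborel (\<lambda>x. u x * Re (g (of_real x) / f (of_real x))) 0"
    unfolding u_def
  proof (rule extremal_orthogonal[OF f ext])
    show "g holomorphic_on UNIV" "g (of_real \<xi>) = 0"
      using h(1) by (auto simp: g_def intro!: holomorphic_intros)
    fix z assume z: "1 \<le> cmod (z - l)"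
    have "cmod (g z) = cmod \<alpha> * cmod (z - of_real \<xi>) * cmod (h z)"
      by (simp add: g_def norm_mult)
    also have "\<dots> \<le> cmod \<alpha> * ((1 + cmod (l - of_real \<xi>) / 1) * cmod (z - l)) * cmod (h z)"
      using z by (intro mult_right_mono mult_left_mono norm_diff_le_mult) auto
    also have "\<dots> = cmod \<alpha> * (1 + cmod (l - of_real \<xi>)) * cmod (f z)"
      by (simp add: h(2) norm_mult mult_ac)
    finally show "cmod (g z) \<le> cmod \<alpha> * (1 + cmod (l - of_real \<xi>)) * cmod (f z)" .
  qed auto
  also have "(\<lambda>x. u x * Re (g (of_real x) / f (of_real x))) = (\<lambda>x. u x * ((x - \<xi>)\<^sup>2 / (cmod (of_real x - l))\<^sup>2))"
  proof
    fix x :: real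
    show "u x * Re (g (of_real x) / f (of_real x)) = u x * ((x - \<xi>)\<^sup>2 / (cmod (of_real x - l))\<^sup>2)"
    proof (cases "f (of_real x) = 0")
      case False
      then have "h (of_real x) \<noteq> 0" "of_real x - l \<noteq> 0" using h(2)[of "of_real x"] by auto
      then have "g (of_real x) / f (of_real x) = \<alpha> * (of_real x - of_real \<xi>) / (of_real x - l)"
        by (simp add: g_def h(2) divide_simps)
      also have "\<dots> = \<alpha> * (of_real x - of_real \<xi>) * cnj (of_real x - l) / of_real ((cmod (of_real x - l))\<^sup>2)"
        by (simp add: complex_div_cnj[of _ "of_real x - l"])
      finally have "Re (g (of_real x) / f (of_real x)) = Re (\<alpha> * (of_real x - of_real \<xi>) * cnj (of_real x - l)) / (cmod (of_real x - l))\<^sup>2"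
        by (simp only: Re_divide_of_real)
      also have "Re (\<alpha> * (of_real x - of_real \<xi>) * cnj (of_real x - l)) = (x - \<xi>)\<^sup>2"
        using b by (simp add: \<alpha>_def power2_eq_square field_simps)
      finally show ?thesis by simp
    qed (simp add: u_def)
  qed
  finally have int: "has_bochner_integral lborel (\<lambda>x. u x * ((x - \<xi>)\<^sup>2 / (cmod (of_real x - l))\<^sup>2)) 0" .
  \<comment> \<open>A nonnegative integrand with integral 0 vanishes almost everywhere, but this one
    vanishes only at \<open>\<xi>\<close> and at the zeros of \<open>f\<close>.\<close>
  then have "AE x in lborel. u x * ((x - \<xi>)\<^sup>2 / (cmod (of_real x - l))\<^sup>2) = 0"
    by (subst integral_nonneg_eq_0_iff_AE[symmetric]) (auto simp: has_bochner_integral_iff u_def)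
  moreover have "AE x in lborel. x \<noteq> \<xi>" by (rule AE_lborel_singleton)
  ultimately have "AE x in (lborel :: real measure). False"
    using entire_nonzero_AE(2)[OF fh f(2)]
  proof eventually_elim
    case (elim x)
    have "of_real x \<noteq> l" using b by auto
    with elim nonzero show False by (auto simp: u_def)
  qed
  then show False using not_AE_lborel_False by blast
qed

text \<open>With \<open>H = f r\<close>, \<open>k = u r\<close> and \<open>N = u |r| powr p\<close>,
  comparing \<open>k\<close> with \<open>N\<close> takes only bounds on \<open>|r|\<close>: from
  above outside \<open>J\<close>, from below on \<open>I\<close>. The distance \<open>d\<close>
  enters the two comparison factors with opposite powers, so the final constant is independent of
  it.\<close>

lemma extremal_zeros_gap:
  assumes f: "f \<in> HpE p E" "f \<noteq> (\<lambda>_. 0)"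
    and ext: "cmod (f (of_real \<xi>) / E (of_real \<xi>)) = point_const p E \<xi> * normE p E f"
    and l: "f (of_real a) = 0" "f (of_real b) = 0" "a < b" 
    and \<eta>: "\<eta> > 0" "\<eta> \<le> 1 / 2" "6 * (16 * M) powr p * \<eta> \<le> 1" "b - a \<le> \<eta>"
    and far: "\<bar>a - \<xi>\<bar> > 2"
  shows "1 \<le> 2 * (16 * M) powr p * 16 powr (p - 1) * (b - a)"
proof -
  define d where "d = \<bar>a - \<xi>\<bar>"
  define \<delta> where "\<delta> = b - a"
  define Cp where "Cp = (16 * M) powr p"
  have Cp: "Cp > 0" using M by (simp add: Cp_def)
  have d: "d > 2" using far by (simp add: d_def)
  have \<delta>: "0 < \<delta>" "\<delta> \<le> \<eta>" using l \<eta> by (auto simp: \<delta>_def)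
  have fh: "f holomorphic_on UNIV" by (rule HpE_holomorphic[OF f(1)])
  obtain h1 where h1: "h1 holomorphic_on UNIV" "\<And>z. f z = (z - of_real a) * h1 z"
    using entire_divide_zero[OF fh l(1)] by blast
  have "h1 (of_real b) = 0" using h1(2)[of "of_real b"] l by auto
  then obtain h where h: "h holomorphic_on UNIV" "\<And>z. h1 z = (z - of_real b) * h z"
    using entire_divide_zero[OF h1(1)] by blast
  have fz: "f z = (z - of_real a) * (z - of_real b) * h z" for z
    using h1(2) h(2) by (simp add: mult_ac)
  define H where "H = (\<lambda>z. (z - of_real \<xi>)\<^sup>2 * h z)"
  have Hh: "H holomorphic_on UNIV" unfolding H_def using h(1) by (intro holomorphic_intros)
  define K where "K = (1 + cmod (of_real a - of_real \<xi> :: complex)) * (1 + cmod (of_real b - of_real \<xi> :: complex))"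
  \<comment> \<open>The radius \<open>1 + \<delta>\<close> about \<open>a\<close> makes the exterior
    of the disc keep distance at least 1 from both zeros.\<close>
  have dom: "cmod (H z) \<le> K * cmod (f z)" if z: "1 + \<delta> \<le> cmod (z - of_real a)" for z
  proof -
    have "cmod (z - of_real a) \<le> cmod (z - of_real b) + \<delta>"
      using norm_triangle_ineq[of "z - of_real b" "of_real b - of_real a"] \<delta>
      by (simp add: \<delta>_def norm_of_real[of "b - a", unfolded of_real_diff])
    then have zb: "1 \<le> cmod (z - of_real b)" and za: "1 \<le> cmod (z - of_real a)" using z \<delta> by auto
    have "cmod (H z) = cmod (z - of_real \<xi>) * cmod (z - of_real \<xi>) * cmod (h z)"
      by (simp add: H_def norm_mult norm_power power2_eq_square)
    also have "\<dots> \<le> ((1 + cmod (of_real a - of_real \<xi>) / 1) * cmod (z - of_real a)) * ((1 + cmod (of_real b - of_real \<xi>) / 1) * cmod (z - of_real b)) * cmod (h z)"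
      using za zb by (intro mult_right_mono mult_mono norm_diff_le_mult) auto
    also have "\<dots> = K * cmod (f z)"
      by (simp add: K_def fz norm_mult mult_ac)
    finally show ?thesis .
  qed
  have K: "K \<ge> 0" by (simp add: K_def)
  have HH: "H \<in> HpE p E"
    by (rule HpE_dom[OF f(1) Hh K _ dom]) (use \<delta> in auto)
  define u N where "u = (\<lambda>x. cmod (f (complex_of_real x) / E (of_real x)) powr p)"
    and "N = (\<lambda>x. cmod (H (complex_of_real x) / E (of_real x)) powr p)"
  define r where "r = (\<lambda>x. (x - \<xi>)\<^sup>2 / ((x - a) * (x - b)))"
  define k where "k = (\<lambda>x. u x * r x)"
  have nonneg: "u x \<ge> 0" "N x \<ge> 0" for x by (auto simp: u_def N_def)
  have quot: "H (of_real x) = f (of_real x) * of_real (r x)" if "f (of_real x) \<noteq> 0" for x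
  proof -
    have "complex_of_real x - of_real a \<noteq> 0" "complex_of_real x - of_real b \<noteq> 0"
      using that fz[of "of_real x"] by auto
    then show ?thesis by (simp add: H_def fz r_def)
  qed
  have kint: "has_bochner_integral lborel k 0"
  proof -
    have "has_bochner_integral lborel (\<lambda>x. u x * Re (H (of_real x) / f (of_real x))) 0"
      unfolding u_def
      by (rule extremal_orthogonal[OF f ext Hh _ K _ dom]) (use \<delta> in \<open>auto simp: H_def\<close>)
    moreover have "(\<lambda>x. u x * Re (H (of_real x) / f (of_real x))) = k"
    proof
      fix x
      show "u x * Re (H (of_real x) / f (of_real x)) = k x"
        by (cases "f (of_real x) = 0") (auto simp: quot k_def u_def)
    qed
    ultimately show ?thesis by simp
  qed
  have Nr: "N x = u x * \<bar>r x\<bar> powr p" if "f (of_real x) \<noteq> 0" for x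
    by (simp add: N_def u_def quot[OF that] norm_mult norm_divide powr_mult powr_divide)
  \<comment> \<open>The margin \<open>\<eta>\<close> keeps the complement of \<open>J\<close> at
    distance at least \<open>\<eta>\<close> from the poles \<open>a\<close> and \<open>b\<close> of
    \<open>r\<close>.\<close>
  define I J where "I = {a..b}" and "J = {a - \<eta>..b + \<eta>}"
  have IJ: "I \<subseteq> J" using \<eta> by (auto simp: I_def J_def)
  have contN: "continuous_on J N"
    unfolding N_def using p_pos by (intro continuous_on_powr' continuous_on_norm HpE_continuous_real[OF E Hh] continuous_intros) auto
  obtain x0 where x0: "x0 \<in> J" "\<And>x. x \<in> J \<Longrightarrow> N x \<le> N x0"
    using continuous_attains_sup[OF _ _ contN] l \<eta> by (auto simp: J_def)
  define S where "S = N x0"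
  \<comment> \<open>If \<open>N\<close> vanished on \<open>J\<close>, that interval would be null,
    since \<open>N\<close> is nonzero almost everywhere.\<close>
  have S: "S > 0"
  proof (rule ccontr)
    assume "\<not> S > 0"
    then have z: "N x = 0" if "x \<in> J" for x
      using x0(2)[OF that] nonneg(2)[of x] by (simp add: S_def)
    have "J \<in> null_sets lborel"
    proof (rule AE_iff_null_sets[THEN iffD2])
      show "AE x in lborel. x \<notin> J"
        using entire_nonzero_AE(2)[OF fh f(2)] AE_lborel_singleton[of \<xi>]
          AE_lborel_singleton[of a] AE_lborel_singleton[of b]
      proof eventually_elim
        case (elim x)
        then have "r x \<noteq> 0" by (simp add: r_def)
        then have "N x \<noteq> 0" using elim nonzero by (simp add: Nr u_def)
        then show ?case using z by auto
      qed
    qed (simp add: J_def)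
    then have "emeasure lborel J = 0" by auto
    then show False using l \<eta> by (simp add: J_def)
  qed
  have intN: "integrable lborel N"
    unfolding N_def by (rule HpE_integrable[OF E HH p_pos])
  have intk: "integrable lborel k" "(\<integral>x. k x \<partial>lborel) = 0"
    using kint by (auto simp: has_bochner_integral_iff)
  have [measurable]: "I \<in> sets borel" "J \<in> sets borel" by (auto simp: I_def J_def)
  have int_ind: "integrable lborel (\<lambda>x. indicator A x * g x)" if "integrable lborel g" "A \<in> sets borel" for A and g :: "real \<Rightarrow> real"
    using integrable_mult_indicator[OF _ that(1), of A] that(2) by simp
  have split: "(\<integral>x. g x \<partial>lborel) = (\<integral>x. indicator A x * g x \<partial>lborel) + (\<integral>x. indicator (- A) x * g x \<partial>lborel)"
    if "integrable lborel g" "A \<in> sets borel" for A and g :: "real \<Rightarrow> real"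
  proof -
    have "(\<integral>x. g x \<partial>lborel) = (\<integral>x. indicator A x * g x + indicator (- A) x * g x \<partial>lborel)"
      by (intro Bochner_Integration.integral_cong) (auto simp: indicator_def)
    then show ?thesis
      using that by (subst (asm) Bochner_Integration.integral_add) (auto intro!: int_ind)
  qed
  \<comment> \<open>Point evaluation at \<open>x0\<close> bounds \<open>S\<close> by
    \<open>Cp\<close> times the whole integral of \<open>N\<close>. As \<open>J\<close> has length
    at most \<open>3 * \<eta>\<close> and \<open>6 * Cp * \<eta> \<le> 1\<close>, its share is at
    most \<open>S / 2\<close> and is absorbed.\<close>
  have S1: "S \<le> 2 * Cp * (\<integral>x. indicator (- J) x * N x \<partial>lborel)"
  proof -
    have "S \<le> (16 * M * normE p E H) powr p"
      unfolding S_def N_def using p_pos by (intro powr_mono2 point_evaluation[OF HH]) auto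
    also have "\<dots> = Cp * (\<integral>x. N x \<partial>lborel)"
      using M by (simp add: powr_mult normE_powr[OF p_pos] Cp_def N_def)
    also have "\<dots> = Cp * (\<integral>x. indicator J x * N x \<partial>lborel) + Cp * (\<integral>x. indicator (- J) x * N x \<partial>lborel)"
      by (subst split[OF intN, of J]) (auto simp: distrib_left)
    also have "Cp * (\<integral>x. indicator J x * N x \<partial>lborel) \<le> S / 2"
    proof -
      have "(\<integral>x. indicator J x * N x \<partial>lborel) \<le> (\<integral>x. indicator J x * S \<partial>lborel)"
      proof (rule integral_mono)
        show "integrable lborel (\<lambda>x. indicator J x * S)"
          by (intro integrable_mult_left integrable_real_indicator) (auto simp: J_def emeasure_lborel_Icc_eq)
        show "integrable lborel (\<lambda>x. indicator J x * N x)"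
          by (intro int_ind intN) auto
        show "indicator J x * N x \<le> indicator J x * S" for x
          using x0(2)[of x] by (simp add: S_def indicator_def)
      qed
      also have "\<dots> = (\<delta> + 2 * \<eta>) * S"
        using l \<eta> by (simp add: J_def \<delta>_def)
      also have "\<dots> \<le> 3 * \<eta> * S"
        using \<delta> S by (intro mult_right_mono) auto
      finally have "Cp * (\<integral>x. indicator J x * N x \<partial>lborel) \<le> Cp * (3 * \<eta> * S)"
        using Cp by (intro mult_left_mono) auto
      also have "\<dots> = (6 * Cp * \<eta>) * S / 2" by simp
      also have "\<dots> \<le> 1 * S / 2"
        using \<eta> S by (intro divide_right_mono mult_right_mono) (auto simp: Cp_def)
      finally show ?thesis by simp
    qed
    finally show ?thesis by simp
  qed
  define A1 A2 where "A1 = (4 * d\<^sup>2 / \<eta>\<^sup>2) powr (p - 1)" and "A2 = (4 * \<delta>\<^sup>2 / d\<^sup>2) powr (p - 1)"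
  \<comment> \<open>Since \<open>N = |r| powr (p - 1) * |k|\<close> almost everywhere, the upper
    bound for \<open>|r|\<close> outside \<open>J\<close> gives \<open>N \<le> A1 * k\<close> there;
    on \<open>J\<close> outside \<open>I\<close> only \<open>k \<ge> 0\<close> is used.\<close>
  have S2: "(\<integral>x. indicator (- J) x * N x \<partial>lborel) \<le> A1 * (\<integral>x. indicator (- I) x * k x \<partial>lborel)"
  proof -
    have "(\<integral>x. indicator (- J) x * N x \<partial>lborel) \<le> (\<integral>x. A1 * (indicator (- I) x * k x) \<partial>lborel)"
    proof (rule integral_mono_AE)
      show "AE x in lborel. indicator (- J) x * N x \<le> A1 * (indicator (- I) x * k x)"
        using entire_nonzero_AE(2)[OF fh f(2)]
      proof eventually_elim
        case (elim x)
        have rpos: "r x \<ge> 0" if "x \<notin> I"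
        proof -
          have "(x - a) * (x - b) \<ge> 0"
            using that l(3) by (auto simp: I_def zero_le_mult_iff)
          then show ?thesis by (simp add: r_def)
        qed
        show ?case
        proof (cases "x \<in> J")
          case True
          have "A1 * (indicator (- I) x * k x) \<ge> 0"
            using rpos nonneg by (auto simp: A1_def k_def indicator_def)
          with True show ?thesis by simp
        next
          case False
          then have xI: "x \<notin> I" using IJ by auto
          have xa: "\<bar>x - a\<bar> \<ge> \<eta>" "\<bar>x - b\<bar> \<ge> \<eta>"
            using False l(3) by (auto simp: J_def)
          have ratio: "\<bar>x - \<xi>\<bar> / \<bar>x - c\<bar> \<le> 2 * d / \<eta>" if "\<bar>x - c\<bar> \<ge> \<eta>" "\<bar>c - \<xi>\<bar> \<le> d + \<eta>" for c
          proof -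
            have "cmod (of_real x - of_real \<xi>) \<le> (1 + cmod (of_real c - of_real \<xi>) / \<eta>) * cmod (of_real x - of_real c)"
              using that \<eta> by (intro norm_diff_le_mult) (auto simp flip: of_real_diff)
            then have "\<bar>x - \<xi>\<bar> \<le> (1 + \<bar>c - \<xi>\<bar> / \<eta>) * \<bar>x - c\<bar>"
              by (simp flip: of_real_diff)
            then have "\<bar>x - \<xi>\<bar> / \<bar>x - c\<bar> \<le> 1 + \<bar>c - \<xi>\<bar> / \<eta>"
              using that \<eta> by (subst pos_divide_le_eq) auto
            also have "\<dots> = (\<eta> + \<bar>c - \<xi>\<bar>) / \<eta>" using \<eta> by (simp add: field_simps)
            \<comment> \<open>From \<open>|c - \<xi>| \<le> d + \<eta>\<close> and
              \<open>2 * \<eta> \<le> 1 < d\<close>.\<close>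
            also have "\<dots> \<le> 2 * d / \<eta>" using that \<eta> d by (intro divide_right_mono) auto
            finally show ?thesis .
          qed
          have "\<bar>r x\<bar> = (\<bar>x - \<xi>\<bar> / \<bar>x - a\<bar>) * (\<bar>x - \<xi>\<bar> / \<bar>x - b\<bar>)"
            by (simp add: r_def abs_mult power2_eq_square)
          also have "\<dots> \<le> (2 * d / \<eta>) * (2 * d / \<eta>)"
            using xa \<eta> d \<delta> by (intro mult_mono ratio) (auto simp: d_def \<delta>_def)
          also have "\<dots> = 4 * d\<^sup>2 / \<eta>\<^sup>2" by (simp add: power2_eq_square)
          finally have rle: "\<bar>r x\<bar> \<le> 4 * d\<^sup>2 / \<eta>\<^sup>2" .
          have "N x = u x * (\<bar>r x\<bar> powr (p - 1) * \<bar>r x\<bar>)"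
            using Nr[OF elim] powr_add[of "\<bar>r x\<bar>" "p - 1" 1] by simp
          also have "\<dots> \<le> u x * (A1 * \<bar>r x\<bar>)"
            unfolding A1_def using rle p nonneg by (intro mult_left_mono mult_right_mono powr_mono2) auto
          also have "\<dots> = A1 * k x"
            using rpos[OF xI] by (simp add: k_def)
          finally show ?thesis using False xI by simp
        qed
      qed
      show "integrable lborel (\<lambda>x. indicator (- J) x * N x)"
        by (intro int_ind intN) auto
      show "integrable lborel (\<lambda>x. A1 * (indicator (- I) x * k x))"
        by (intro integrable_mult_right int_ind intk) auto
    qed
    then show ?thesis by simp
  qed
  have S3: "(\<integral>x. indicator (- I) x * k x \<partial>lborel) \<le> A2 * S * \<delta>"
  proof -
    \<comment> \<open>The integral of \<open>k\<close> over the whole line is 0, so its nonnegative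
      contribution outside \<open>I\<close> is balanced by the one on \<open>I\<close>.\<close>
    have "(\<integral>x. indicator (- I) x * k x \<partial>lborel) = (\<integral>x. - (indicator I x * k x) \<partial>lborel)"
      using split[OF intk(1), of I] intk(2) by simp
    also have "\<dots> \<le> (\<integral>x. indicator I x * (A2 * S) \<partial>lborel)"
    proof (rule integral_mono_AE)
      show "integrable lborel (\<lambda>x. indicator I x * (A2 * S))"
        by (intro integrable_mult_left integrable_real_indicator) (auto simp: I_def emeasure_lborel_Icc_eq)
      show "integrable lborel (\<lambda>x. - (indicator I x * k x))"
        by (intro Bochner_Integration.integrable_minus int_ind intk) auto
      show "AE x in lborel. - (indicator I x * k x) \<le> indicator I x * (A2 * S)"
        using entire_nonzero_AE(2)[OF fh f(2)]
      proof eventually_elim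
        case (elim x)
        show ?case
        proof (cases "x \<in> I")
          case True
          have xab: "x \<noteq> a" "x \<noteq> b" using elim l by auto
          then have x: "a < x" "x < b" using True by (auto simp: I_def)
          have "d \<le> \<bar>x - \<xi>\<bar> + \<bar>x - a\<bar>" unfolding d_def by linarith
          moreover have "\<bar>x - a\<bar> \<le> 1 / 2" using x \<eta> by linarith
          ultimately have "d / 2 \<le> \<bar>x - \<xi>\<bar>" using d by linarith
          then have xx: "(d / 2)\<^sup>2 \<le> (x - \<xi>)\<^sup>2"
            using d power_mono[of "d / 2" "\<bar>x - \<xi>\<bar>" 2] by simp
          have xpos: "(x - \<xi>)\<^sup>2 > 0" using xx d by (auto intro: less_le_trans[OF _ xx])
          have rr: "\<bar>r x\<bar> = (x - \<xi>)\<^sup>2 / ((x - a) * (b - x))" and rneg: "r x < 0"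
          proof -
            have "(x - a) * (x - b) = - ((x - a) * (b - x))" by (simp add: algebra_simps)
            then have "r x = - ((x - \<xi>)\<^sup>2 / ((x - a) * (b - x)))"
              unfolding r_def by simp
            moreover have "(x - \<xi>)\<^sup>2 / ((x - a) * (b - x)) > 0"
              using x by (intro divide_pos_pos xpos mult_pos_pos) auto
            ultimately show "\<bar>r x\<bar> = (x - \<xi>)\<^sup>2 / ((x - a) * (b - x))" "r x < 0"
              by linarith+
          qed
          have "inverse \<bar>r x\<bar> = ((x - a) * (b - x)) / (x - \<xi>)\<^sup>2"
            by (simp add: rr)
          also have "\<dots> \<le> (\<delta> * \<delta>) / (d / 2)\<^sup>2"
            using x xx d by (intro frac_le mult_mono) (auto simp: \<delta>_def)
          also have "\<dots> = 4 * \<delta>\<^sup>2 / d\<^sup>2" by (simp add: power2_eq_square)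
          finally have inv: "inverse \<bar>r x\<bar> \<le> 4 * \<delta>\<^sup>2 / d\<^sup>2" .
          have "- k x = u x * \<bar>r x\<bar>" using rneg by (simp add: k_def)
          \<comment> \<open>Written this way, \<open>u x * |r x|\<close> becomes \<open>N x\<close>
            times a power of \<open>1 / |r x|\<close>, which \<open>inv\<close> bounds on
            \<open>I\<close>.\<close>
          also have "\<bar>r x\<bar> = (inverse \<bar>r x\<bar>) powr (p - 1) * \<bar>r x\<bar> powr p"
          proof -
            have "(inverse \<bar>r x\<bar>) powr (p - 1) * \<bar>r x\<bar> powr (p - 1) = 1"
              using rneg by (subst powr_mult[symmetric]) auto
            moreover have "\<bar>r x\<bar> powr p = \<bar>r x\<bar> powr (p - 1) * \<bar>r x\<bar>"
              using powr_add[of "\<bar>r x\<bar>" "p - 1" 1] by simp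
            ultimately show ?thesis by (simp only: mult.assoc[symmetric] mult_1_left)
          qed
          also have "u x * ((inverse \<bar>r x\<bar>) powr (p - 1) * \<bar>r x\<bar> powr p) = (inverse \<bar>r x\<bar>) powr (p - 1) * N x"
            by (simp add: Nr[OF elim])
          also have "\<dots> \<le> A2 * S"
            unfolding A2_def S_def using inv p True IJ nonneg by (intro mult_mono powr_mono2 x0) auto
          finally show ?thesis using True by simp
        qed simp
      qed
    qed
    also have "\<dots> = A2 * S * \<delta>" using l by (simp add: I_def \<delta>_def)
    finally show ?thesis .
  qed
  note S1
  also have "2 * Cp * (\<integral>x. indicator (- J) x * N x \<partial>lborel) \<le> 2 * Cp * (A1 * (\<integral>x. indicator (- I) x * k x \<partial>lborel))"
    using S2 Cp by (intro mult_left_mono) auto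
  also have "\<dots> \<le> 2 * Cp * (A1 * (A2 * S * \<delta>))"
    using S3 Cp by (intro mult_left_mono) (auto simp: A1_def)
  finally have "S \<le> 2 * Cp * (A1 * (A2 * S * \<delta>))" .
  then have "1 * S \<le> (2 * Cp * (A1 * A2) * \<delta>) * S" by (simp add: mult_ac)
  then have "1 \<le> 2 * Cp * (A1 * A2) * \<delta>" using S by (rule mult_right_le_imp_le)
  \<comment> \<open>Here \<open>d\<close> cancels; what remains is governed by
    \<open>\<delta> / \<eta> \<le> 1\<close>.\<close>
  also have "A1 * A2 = (16 * (\<delta> / \<eta>)\<^sup>2) powr (p - 1)"
    unfolding A1_def A2_def using d \<eta> by (subst powr_mult[symmetric]) (auto simp: power_divide)
  also have "2 * Cp * (16 * (\<delta> / \<eta>)\<^sup>2) powr (p - 1) * \<delta> \<le> 2 * Cp * (16 * 1) powr (p - 1) * \<delta>"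
  proof -
    have "(\<delta> / \<eta>)\<^sup>2 \<le> 1" using \<delta> \<eta> by (intro power_le_one) auto
    then show ?thesis using \<delta> Cp p by (intro mult_right_mono mult_left_mono powr_mono2) auto
  qed
  finally show ?thesis by (simp add: Cp_def \<delta>_def)
qed

text \<open>Two zeros are either more than \<open>\<eta>\<close> apart, or far from
  \<open>\<xi>\<close> and covered by \<open>extremal_zeros_gap\<close>, or among the finitely many
  zeros near \<open>\<xi>\<close>.\<close>

lemma extremal_zeros_separated:
  assumes f: "f \<in> HpE p E" "f \<noteq> (\<lambda>_. 0)"
    and ext: "cmod (f (of_real \<xi>) / E (of_real \<xi>)) = point_const p E \<xi> * normE p E f"
  shows "\<exists>\<delta>>0. \<forall>z1 z2. f z1 = 0 \<longrightarrow> f z2 = 0 \<longrightarrow> z1 \<noteq> z2 \<longrightarrow> cmod (z1 - z2) > \<delta>"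
proof -
  define Cp where "Cp = (16 * M) powr p"
  have Cp: "Cp > 0" using M by (simp add: Cp_def)
  define \<eta> where "\<eta> = min (1 / 2) (1 / (6 * Cp))"
  have \<eta>: "\<eta> > 0" "\<eta> \<le> 1 / 2" "6 * Cp * \<eta> \<le> 1"
  proof -
    have "6 * Cp * \<eta> \<le> 6 * Cp * (1 / (6 * Cp))"
      using Cp by (intro mult_left_mono) (auto simp: \<eta>_def)
    then show "6 * Cp * \<eta> \<le> 1" using Cp by simp
  qed (use Cp in \<open>auto simp: \<eta>_def\<close>)
  have fh: "f holomorphic_on UNIV" by (rule HpE_holomorphic[OF f(1)])
  \<comment> \<open>Radius 3 holds both zeros when \<open>|a - \<xi>| \<le> 2\<close> and
    \<open>b - a \<le> \<eta> \<le> 1 / 2\<close>.\<close>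
  define Z where "Z = {z \<in> cball (of_real \<xi>) 3. f z = 0}"
  have "finite Z"
  proof (cases "f constant_on UNIV")
    case True
    then obtain c where c: "\<And>z. f z = c" by (auto simp: constant_on_def)
    with f(2) have "c \<noteq> 0" by auto
    with c have "Z = {}" by (simp add: Z_def)
    then show ?thesis by simp
  next
    case False
    then show ?thesis
      unfolding Z_def by (intro holomorphic_compact_finite_zeros[OF fh]) auto
  qed
  \<comment> \<open>The inserted 1 keeps \<open>Min D\<close> meaningful when \<open>Z\<close> has
    fewer than two points.\<close>
  define D where "D = insert 1 ((\<lambda>(z1, z2). cmod (z1 - z2)) ` {(z1, z2) \<in> Z \<times> Z. z1 \<noteq> z2})"
  have D: "finite D" "D \<noteq> {}" "\<And>x. x \<in> D \<Longrightarrow> x > 0"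
  proof -
    have "finite {(z1, z2) \<in> Z \<times> Z. z1 \<noteq> z2}"
      by (rule finite_subset[of _ "Z \<times> Z"]) (use \<open>finite Z\<close> in auto)
    then show "finite D" unfolding D_def by (intro finite.insertI finite_imageI)
  qed (auto simp: D_def)
  \<comment> \<open>Each term is half of the lower bound valid in its case, which makes the final
    inequality strict.\<close>
  define \<delta> where "\<delta> = min (Min D / 2) (min (\<eta> / 2) (1 / (4 * Cp * 16 powr (p - 1))))"
  have pos: "\<delta> > 0" using D Cp \<eta> by (simp add: \<delta>_def)
  have main: "b - a > \<delta>" if l: "f (of_real a) = 0" "f (of_real b) = 0" "a < b" for a b
  proof (cases "b - a \<le> \<eta>")
    case True
    show ?thesis
    proof (cases "\<bar>a - \<xi>\<bar> > 2")
      case far: True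
      have "1 \<le> 2 * Cp * 16 powr (p - 1) * (b - a)"
        unfolding Cp_def by (rule extremal_zeros_gap[OF f ext l \<eta>(1,2) _ True far]) (use \<eta>(3) in \<open>simp add: Cp_def\<close>)
      then have "b - a \<ge> 1 / (2 * Cp * 16 powr (p - 1))"
        using Cp by (simp add: field_simps)
      moreover have "1 / (4 * Cp * 16 powr (p - 1)) < 1 / (2 * Cp * 16 powr (p - 1))"
        using Cp by (intro divide_strict_left_mono) auto
      ultimately show ?thesis by (simp add: \<delta>_def)
    next
      case False
      then have "complex_of_real a \<in> Z" "complex_of_real b \<in> Z"
        using l True \<eta>(2) by (auto simp: Z_def dist_norm simp flip: of_real_diff)
      then have "cmod (of_real a - of_real b) \<in> D"
        using l(3) by (auto simp: D_def intro!: image_eqI[of _ _ "(complex_of_real a, complex_of_real b)"])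
      then have "Min D \<le> b - a"
        using D(1) l(3) by (intro Min_le) (auto simp flip: of_real_diff)
      moreover have "Min D > 0" using D by simp
      ultimately show ?thesis by (simp add: \<delta>_def)
    qed
  qed (use \<eta> in \<open>simp add: \<delta>_def\<close>)
  show ?thesis
  proof (intro exI[of _ \<delta>] conjI pos allI impI)
    fix z1 z2 assume z: "f z1 = 0" "f z2 = 0" "z1 \<noteq> z2"
    have re: "z1 = of_real (Re z1)" "z2 = of_real (Re z2)"
      using extremal_zeros_real[OF f ext] z by (auto simp: complex_eq_iff)
    then have "Re z1 \<noteq> Re z2" using z(3) by metis
    moreover have "cmod (z1 - z2) = \<bar>Re z1 - Re z2\<bar>"
      by (subst re(1), subst re(2)) (simp flip: of_real_diff)
    ultimately show "cmod (z1 - z2) > \<delta>"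
      using main[of "Re z1" "Re z2"] main[of "Re z2" "Re z1"] re z by (cases "Re z1" "Re z2" rule: linorder_cases) auto
  qed
qed

end

theorem theorem4:
  fixes E f :: "complex \<Rightarrow> complex" and p \<xi> :: real and \<phi> :: "real \<Rightarrow> real"
  assumes "hermite_biehler E"
    and "\<forall>x::real. E (of_real x) \<noteq> 0"
    and "phase_function E \<phi>"
    and "\<exists>M. AE x in lborel. \<bar>deriv \<phi> x\<bar> \<le> M"
    and "p \<ge> 1"
    and "f \<in> HpE p E"
    and "f \<noteq> (\<lambda>_. 0)"
    and "cmod (f (of_real \<xi>) / E (of_real \<xi>)) = point_const p E \<xi> * normE p E f"
  shows "\<exists>\<delta>>0. \<forall>z1 z2. f z1 = 0 \<longrightarrow> f z2 = 0 \<longrightarrow> z1 \<noteq> z2 \<longrightarrow> cmod (z1 - z2) > \<delta>"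
proof -
  obtain M where M: "AE x in lborel. \<bar>deriv \<phi> x\<bar> \<le> M"
    using assms(4) by blast
  \<comment> \<open>Enlarging the bound to at least 1 keeps the half-width \<open>r\<close> of
    \<open>HpE_point_evaluation\<close> at most \<open>1 / 2\<close>, inside the strip covered by
    \<open>phase_quotient_lower_bound\<close>.\<close>
  interpret bounded_phase E \<phi> "max 1 M" p
  proof
    show "AE x in lborel. \<bar>deriv \<phi> x\<bar> \<le> max 1 M"
      using M by eventually_elim simp
  qed (use assms in auto)
  show ?thesis
    by (rule extremal_zeros_separated[OF assms(6,7,8)])
qed

end
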